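(* The $2$-variable series $\widehat{\widehat{Z}}_{[k]}(q,t)$ is an invariant of the negative definite plumbed $3$-manifold $Y=Y(\Gamma)$ with a $\mathrm{spin}^c$ structure $[k]$, and its specialization at $t=1$ equals $\widehat{Z}_{Y,[k]}(q)$. Explicitly: (1) if $\Gamma_1,\Gamma_2$ are negative definite plumbing trees related by a finite sequence of type (a) and type (b) Neumann moves and their inverses (equivalently, representing the same $3$-manifold), and $[k_1],[k_2]$ are $\mathrm{spin}^c$ structures corresponding to each other under the composition of the bijections $\alpha^{\pm1}$ associated with these moves, then $\widehat{\widehat{Z}}_{[k_1]}(q,t)=\widehat{\widehat{Z}}_{[k_2]}(q,t)$ for any choice of representatives $k_1\in[k_1]$, $k_2\in[k_2]$ used in the construction; (2) for every negative definite plumbing tree $\Gamma$ and $k\in m+2\mathbb{Z}^s$, $\widehat{\widehat{Z}}_{[k]}(q,1)=\widehat{Z}_a(q)$, where $a=k-Mu$.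
   Context: **Plumbings.** A plumbing tree $\Gamma$ is a finite tree with vertices $v_1,\dots,v_s$ and integer weights $m_i=m(v_i)$. Let $\delta_i=\delta_{v_i}$ be the degree of $v_i$, $m=(m_1,\dots,m_s)$, $\delta=(\delta_1,\dots,\delta_s)$. The matrix $M$ is the symmetric $s\times s$ matrix with $M_{ii}=m_i$, $M_{ij}=1$ if $i\ne j$ and $v_i,v_j$ are adjacent, and $0$ otherwise. $\Gamma$ is negative definite if $M$ is. $Y(\Gamma)$ is the $3$-manifold obtained by surgery on the framed link with one unknot of framing $m(v)$ for each vertex $v$, adjacent vertices giving Hopf-linked unknots. Write $\langle x,y\rangle=x^tMy$, $\cdot$ for the dot product, $u=(1,\dots,1)$ (so $Mu=m+\delta$), and $(k-Mu)^2:=(k-Mu)^tM^{-1}(k-Mu)$. $\mathrm{Spin}^c$ structures on $Y(\Gamma)$ are identified with classes $[k]\in (m+2\mathbb{Z}^s)/2M\mathbb{Z}^s$; an alternative identification is with $(\delta+2\mathbb{Z}^s)/2M\mathbb{Z}^s$, and the two are related by $[k]\mapsto[k-Mu]$. **Neumann moves.** Type (a): $\Gamma$ has an edge joining $v_1,v_2$; $\Gamma'$ is obtained by replacing this edge by a path $v_1',v_0',v_2'$, where the new vertex $v_0'$ has weight $-1$ and $v_1',v_2'$ have weights $m_1-1,m_2-1$ (all else unchanged). Type (b): $\Gamma'$ is obtained by attaching a new leaf $v_0'$ of weight $-1$ to $v_1$, and changing the weight of $v_1$ to $m_1-1$. The vertices of $\Gamma'$ are ordered $v_0',v_1',\dots,v_s'$.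 By a theorem of Neumann, two negative definite plumbing trees represent the same $3$-manifold if and only if they are related by a finite sequence of such moves and their inverses. The bijection $\alpha$ from $(m+2\mathbb{Z}^s)/2M\mathbb{Z}^s$ to $(m'+2\mathbb{Z}^{s+1})/2M'\mathbb{Z}^{s+1}$ is $[k]\mapsto[k']$, with $k'=(0,k)+(1,-1,-1,0,\dots,0)$ for type (a) and $k'=(0,k)+(-1,1,0,\dots,0)$ for type (b). **The family $\widehat F$.** For $0\le n\le2$, $\widehat F_n(r)$ is the coefficient of $z^{-r}$ in the Laurent polynomial $(z-z^{-1})^{2-n}$. For $n\ge3$, $\widehat F_n(r)\in\mathbb{Q}$ is the average of the coefficients of $z^{-r}$ in $\big(-\sum_{i\ge0}z^{2i+1}\big)^{n-2}$ and in $\big(\sum_{i\ge0}z^{-(2i+1)}\big)^{n-2}$ (the expansions of $(z-z^{-1})^{2-n}$ for $|z|<1$ and $|z|>1$). Put $\widehat F_{\Gamma,k}(x)=\prod_v\widehat F_{\delta_v}\big((2Mx+k-Mu)_v\big)$ for $x\in\mathbb{Z}^s$, the product over all vertices $v$ of $\Gamma$. **The two-variable series.** For $k\in m+2\mathbb{Z}^s$ and $x\in\mathbb{Z}^s$ let $\chi_k(x)=-(k\cdot x+\langle x,x\rangle)/2$, $\Delta_k=-\frac{(k-Mu)^2+3s+\sum_v m_v}{4}$, $\Theta_k=\frac{k\cdot u-\langle u,u\rangle}{2}$, $\varepsilon_k(x)=\Delta_k+2\chi_k(x)+\langle x,u\rangle$, $\theta_k(x)=\Theta_k+\langle x,u\rangle$.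 For $n\in\mathbb{Z}$ let $P_k^n=\sum_{x\in\mathbb{Z}^s,\ \chi_k(x)\le n}\widehat F_{\Gamma,k}(x)q^{\varepsilon_k(x)}t^{\theta_k(x)}$ (a finite sum; it is the sum of the weights of the vertices in grading $n$ of the weighted graded root). Then $\widehat{\widehat{Z}}_{[k]}(q,t)$ is the coefficientwise limit of $P_k^n$ as $n\to\infty$ (each coefficient is eventually constant in $n$); equivalently $\widehat{\widehat{Z}}_{[k]}(q,t)=\sum_{x\in\mathbb{Z}^s}\widehat F_{\Gamma,k}(x)q^{\varepsilon_k(x)}t^{\theta_k(x)}$. It is $q^{\Delta_k}$ times a Laurent series in $q$ whose coefficients are Laurent polynomials in $t$. **The GPPV series.** For $a\in\delta+2\mathbb{Z}^s$, $$\widehat Z_a(q)=q^{-\frac{3s+\sum_v m_v}{4}}\sum_{\ell\in a+2M\mathbb{Z}^s}\Big[\prod_v \mathrm{v.p.}\frac{1}{2\pi i}\oint_{|z_v|=1}\frac{1}{z_v}\Big(z_v-\frac1{z_v}\Big)^{2-\delta_v}z_v^{\ell_v}\,dz_v\Big]q^{-\frac{\ell^tM^{-1}\ell}{4}},$$ where v.p. denotes the average of the integrals over $|z_v|=1+\epsilon$ and $|z_v|=1-\epsilon$ for small $\epsilon>0$. For the $\mathrm{spin}^c$ structure $[k]$, $\widehat Z_{Y,[k]}(q):=\widehat Z_a(q)$ with $a=k-Mu$. *)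

theory Defs
  imports
    "HOL-Library.Poly_Mapping"
    "HOL-Computational_Algebra.Formal_Laurent_Series"
    "HOL-Combinatorics.Permutations"
    "HOL-Complex_Analysis.Contour_Integration"
    "Jordan_Normal_Form.Gauss_Jordan_Elimination"
    "Jordan_Normal_Form.Determinant"
begin

unbundle no vec_syntax and no inner_syntax
no_notation fps_nth (infixl "$" 75)

section \<open>Plumbing trees\<close>

text \<open>
  The vertices of a plumbing with \<open>s\<close> weights are \<open>0, \<dots>, s - 1\<close>, and an edge is the
  two-element set of its endpoints.
\<close>

record plumbing =
  weights :: "int Matrix.vec"
  edges :: "nat set set"

abbreviation nverts :: "plumbing \<Rightarrow> nat" where
  "nverts G \<equiv> dim_vec (weights G)"

definition plumbing_graph :: "plumbing \<Rightarrow> bool" where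
  "plumbing_graph G \<longleftrightarrow> (\<forall>e \<in> edges G. e \<subseteq> {..<nverts G} \<and> card e = 2)"

definition connected_plumbing :: "plumbing \<Rightarrow> bool" where
  "connected_plumbing G \<longleftrightarrow> nverts G > 0 \<and>
     (\<forall>u < nverts G. \<forall>v < nverts G. (u, v) \<in> {(x, y). {x, y} \<in> edges G}\<^sup>*)"

definition acyclic_plumbing :: "plumbing \<Rightarrow> bool" where
  "acyclic_plumbing G \<longleftrightarrow> \<not> (\<exists>c. length c \<ge> 3 \<and> distinct c \<and>
     (\<forall>i < length c. {c ! i, c ! (Suc i mod length c)} \<in> edges G))"

definition plumbing_tree :: "plumbing \<Rightarrow> bool" where
  "plumbing_tree G \<longleftrightarrow> plumbing_graph G \<and> connected_plumbing G \<and> acyclic_plumbing G"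

definition vertex_degree :: "plumbing \<Rightarrow> nat \<Rightarrow> nat" where
  "vertex_degree G v = card {e \<in> edges G. v \<in> e}"

definition plumbing_matrix :: "plumbing \<Rightarrow> int Matrix.mat" where
  "plumbing_matrix G = Matrix.mat (nverts G) (nverts G)
     (\<lambda>(i, j). if i = j then weights G $ i else if {i, j} \<in> edges G then 1 else 0)"

definition negative_definite :: "plumbing \<Rightarrow> bool" where
  "negative_definite G \<longleftrightarrow>
     (\<forall>x \<in> carrier_vec (nverts G). x \<noteq> 0\<^sub>v (nverts G) \<longrightarrow>
        x \<bullet> (map_mat real_of_int (plumbing_matrix G) *\<^sub>v x) < 0)"

definition ones :: "plumbing \<Rightarrow> int Matrix.vec" where
  "ones G = Matrix.vec (nverts G) (\<lambda>_. 1)"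

definition form :: "plumbing \<Rightarrow> int Matrix.vec \<Rightarrow> int Matrix.vec \<Rightarrow> int" where
  "form G x y = x \<bullet> (plumbing_matrix G *\<^sub>v y)"

definition inv_square :: "plumbing \<Rightarrow> int Matrix.vec \<Rightarrow> rat" where
  "inv_square G y = map_vec rat_of_int y \<bullet>
     (the (mat_inverse (map_mat rat_of_int (plumbing_matrix G))) *\<^sub>v map_vec rat_of_int y)"

section \<open>Spin-c structures\<close>

definition char_vecs :: "plumbing \<Rightarrow> int Matrix.vec set" where
  "char_vecs G = {weights G + 2 \<cdot>\<^sub>v x | x. x \<in> carrier_vec (nverts G)}"

definition lattice_class :: "plumbing \<Rightarrow> int Matrix.vec \<Rightarrow> int Matrix.vec set" where
  "lattice_class G k = {k + 2 \<cdot>\<^sub>v (plumbing_matrix G *\<^sub>v x) | x. x \<in> carrier_vec (nverts G)}"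

definition spinc_structures :: "plumbing \<Rightarrow> int Matrix.vec set set" where
  "spinc_structures G = lattice_class G ` char_vecs G"

section \<open>Neumann moves\<close>

text \<open>
  The new vertex of a blow-up gets the number \<open>0\<close> and the old vertex \<open>i\<close> becomes \<open>Suc i\<close>.
  Blow-ups are allowed at arbitrary edges and vertices, not just at those involving the first two.
\<close>

definition blow_up_edge :: "nat \<Rightarrow> nat \<Rightarrow> plumbing \<Rightarrow> plumbing" where
  "blow_up_edge i j G =
     \<lparr> weights = vCons (-1) (weights G - unit_vec (nverts G) i - unit_vec (nverts G) j),
       edges = (\<lambda>e. Suc ` e) ` (edges G - {{i, j}}) \<union> {{0, Suc i}, {0, Suc j}} \<rparr>"

definition blow_up_vertex :: "nat \<Rightarrow> plumbing \<Rightarrow> plumbing" where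
  "blow_up_vertex i G =
     \<lparr> weights = vCons (-1) (weights G - unit_vec (nverts G) i),
       edges = (\<lambda>e. Suc ` e) ` edges G \<union> {{0, Suc i}} \<rparr>"

definition permute_vec :: "(nat \<Rightarrow> nat) \<Rightarrow> 'a Matrix.vec \<Rightarrow> 'a Matrix.vec" where
  "permute_vec \<pi> x = Matrix.vec (dim_vec x) (\<lambda>i. x $ inv_into UNIV \<pi> i)"

definition relabel :: "(nat \<Rightarrow> nat) \<Rightarrow> plumbing \<Rightarrow> plumbing" where
  "relabel \<pi> G = \<lparr> weights = permute_vec \<pi> (weights G), edges = (\<lambda>e. \<pi> ` e) ` edges G \<rparr>"

text \<open>
  The graph of the bijection between spin-c structures for each elementary move. Renumbering the
  vertices counts as a move, since plumbing trees are considered up to isomorphism.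
\<close>

inductive spinc_move :: "plumbing \<times> int Matrix.vec set \<Rightarrow> plumbing \<times> int Matrix.vec set \<Rightarrow> bool" where
  type_a: "spinc_move (G, lattice_class G k)
      (blow_up_edge i j G, lattice_class (blow_up_edge i j G)
        (vCons 0 k + vCons 1 (- unit_vec (nverts G) i - unit_vec (nverts G) j)))"
    if "plumbing_tree G" "{i, j} \<in> edges G" "k \<in> char_vecs G"
| type_b: "spinc_move (G, lattice_class G k)
      (blow_up_vertex i G, lattice_class (blow_up_vertex i G)
        (vCons 0 k + vCons (-1) (unit_vec (nverts G) i)))"
    if "plumbing_tree G" "i < nverts G" "k \<in> char_vecs G"
| renumber: "spinc_move (G, lattice_class G k)
      (relabel \<pi> G, lattice_class (relabel \<pi> G) (permute_vec \<pi> k))"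
    if "plumbing_tree G" "\<pi> permutes {..<nverts G}" "k \<in> char_vecs G"

definition neumann_related ::
    "plumbing \<times> int Matrix.vec set \<Rightarrow> plumbing \<times> int Matrix.vec set \<Rightarrow> bool" where
  "neumann_related = equivclp spinc_move"

section \<open>The family of coefficient functions\<close>

text \<open>
  For \<open>n \<ge> 3\<close> both expansions are the image of an fps in one variable, namely \<open>z\<close> for
  \<open>\<bar>z\<bar> < 1\<close> and \<open>inverse z\<close> for \<open>\<bar>z\<bar> > 1\<close>; hence the opposite signs of the index.
\<close>

definition odd_series :: "rat fls" where
  "odd_series = fps_to_fls (Abs_fps (\<lambda>j. if odd j then 1 else 0))"

definition Fhat :: "nat \<Rightarrow> int \<Rightarrow> rat" where
  "Fhat n r =
     (if n \<le> 2 then fls_nth ((fls_X - fls_X_inv) ^ (2 - n)) (- r)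
      else (fls_nth ((- odd_series) ^ (n - 2)) (- r) + fls_nth (odd_series ^ (n - 2)) r) / 2)"

definition Fhat_graph :: "plumbing \<Rightarrow> int Matrix.vec \<Rightarrow> int Matrix.vec \<Rightarrow> rat" where
  "Fhat_graph G k x = (\<Prod>v < nverts G. Fhat (vertex_degree G v)
     ((2 \<cdot>\<^sub>v (plumbing_matrix G *\<^sub>v x) + k - plumbing_matrix G *\<^sub>v ones G) $ v))"

section \<open>The two-variable series\<close>

definition chi :: "plumbing \<Rightarrow> int Matrix.vec \<Rightarrow> int Matrix.vec \<Rightarrow> rat" where
  "chi G k x = - of_int (k \<bullet> x + form G x x) / 2"

definition normalization :: "plumbing \<Rightarrow> rat" where
  "normalization G = of_int (3 * int (nverts G) + (\<Sum>v < nverts G. weights G $ v)) / 4"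

definition Delta :: "plumbing \<Rightarrow> int Matrix.vec \<Rightarrow> rat" where
  "Delta G k = - inv_square G (k - plumbing_matrix G *\<^sub>v ones G) / 4 - normalization G"

definition Theta :: "plumbing \<Rightarrow> int Matrix.vec \<Rightarrow> rat" where
  "Theta G k = of_int (k \<bullet> ones G - form G (ones G) (ones G)) / 2"

definition eps :: "plumbing \<Rightarrow> int Matrix.vec \<Rightarrow> int Matrix.vec \<Rightarrow> rat" where
  "eps G k x = Delta G k + 2 * chi G k x + of_int (form G x (ones G))"

definition theta :: "plumbing \<Rightarrow> int Matrix.vec \<Rightarrow> int Matrix.vec \<Rightarrow> rat" where
  "theta G k x = Theta G k + of_int (form G x (ones G))"

text \<open>
  Finite sums of monomials \<open>c q\<^sup>e t\<^sup>f\<close> with rational exponents are finitely supported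
  functions of \<open>(e, f)\<close>; infinite ones are arbitrary functions of \<open>(e, f)\<close>.
\<close>

definition partial_series :: "plumbing \<Rightarrow> int Matrix.vec \<Rightarrow> int \<Rightarrow> (rat \<times> rat) \<Rightarrow>\<^sub>0 rat" where
  "partial_series G k n = (\<Sum>x \<in> {x \<in> carrier_vec (nverts G). chi G k x \<le> of_int n}.
     Poly_Mapping.single (eps G k x, theta G k x) (Fhat_graph G k x))"

definition eventual_value :: "'a filter \<Rightarrow> ('a \<Rightarrow> 'b) \<Rightarrow> 'b" where
  "eventual_value F f = (THE c. \<forall>\<^sub>F n in F. f n = c)"

definition two_variable_series :: "plumbing \<Rightarrow> int Matrix.vec \<Rightarrow> rat \<times> rat \<Rightarrow> rat" where
  "two_variable_series G k p = eventual_value at_top (\<lambda>n. Poly_Mapping.lookup (partial_series G k n) p)"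

definition specialize_t_1 :: "(rat \<times> rat \<Rightarrow> rat) \<Rightarrow> rat \<Rightarrow> rat" where
  "specialize_t_1 Z e = (\<Sum>f | Z (e, f) \<noteq> 0. Z (e, f))"

section \<open>The GPPV series\<close>

definition pv_integral :: "(complex \<Rightarrow> complex) \<Rightarrow> complex" where
  "pv_integral f = eventual_value (at_right (0 :: real))
     (\<lambda>\<epsilon>. (contour_integral (circlepath 0 (1 + \<epsilon>)) f +
           contour_integral (circlepath 0 (1 - \<epsilon>)) f) / 2)"

definition GPPV_bracket :: "plumbing \<Rightarrow> int Matrix.vec \<Rightarrow> complex" where
  "GPPV_bracket G l = (\<Prod>v < nverts G. 1 / (2 * of_real pi * \<i>) *
     pv_integral (\<lambda>z. 1 / z * (z - 1 / z) powi (2 - int (vertex_degree G v)) * z powi (l $ v)))"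

text \<open>\<open>GPPV_series G a e\<close> is the coefficient of \<open>q\<^sup>e\<close>.\<close>

definition GPPV_series :: "plumbing \<Rightarrow> int Matrix.vec \<Rightarrow> rat \<Rightarrow> complex" where
  "GPPV_series G a e =
     (\<Sum>l \<in> {l \<in> lattice_class G a. - normalization G - inv_square G l / 4 = e}.
        GPPV_bracket G l)"

section \<open>Well-definedness for negative definite plumbings\<close>

lemma plumbing_matrix_carrier [simp]:
  "plumbing_matrix G \<in> carrier_mat (nverts G) (nverts G)"
  by (simp add: plumbing_matrix_def)

lemma symmetric_plumbing_matrix:
  "i < nverts G \<Longrightarrow> j < nverts G \<Longrightarrow> plumbing_matrix G $$ (i, j) = plumbing_matrix G $$ (j, i)"
  by (auto simp: plumbing_matrix_def insert_commute)

lemma ones_carrier [simp]: "ones G \<in> carrier_vec (nverts G)"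
  by (simp add: ones_def)

lemma form_commute:
  assumes "A \<in> carrier_mat n n" "\<And>i j. i < n \<Longrightarrow> j < n \<Longrightarrow> A $$ (i, j) = A $$ (j, i)"
    "x \<in> carrier_vec n" "y \<in> carrier_vec n"
  shows "x \<bullet> (A *\<^sub>v y) = y \<bullet> (A *\<^sub>v (x :: 'a :: comm_ring_1 Matrix.vec))"
proof -
  have "transpose_mat A = A"
    using assms(1,2) by (intro eq_matI) auto
  then have "(A *\<^sub>v x) \<bullet> y = x \<bullet> (A *\<^sub>v y)"
    using transpose_vec_mult_scalar[of A n n y x] assms by simp
  moreover have "(A *\<^sub>v x) \<bullet> y = y \<bullet> (A *\<^sub>v x)"
    by (rule comm_scalar_prod[of _ n]) (use assms in auto)
  ultimately show ?thesis by simp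
qed

lemma quadratic_expand:
  fixes A :: "real Matrix.mat"
  assumes A: "A \<in> carrier_mat n n"
    and sym: "\<And>i j. i < n \<Longrightarrow> j < n \<Longrightarrow> A $$ (i, j) = A $$ (j, i)"
    and x: "x \<in> carrier_vec n" and y: "y \<in> carrier_vec n"
  shows "(x + t \<cdot>\<^sub>v y) \<bullet> (A *\<^sub>v (x + t \<cdot>\<^sub>v y)) =
    x \<bullet> (A *\<^sub>v x) + 2 * t * (x \<bullet> (A *\<^sub>v y)) + t\<^sup>2 * (y \<bullet> (A *\<^sub>v y))"
proof -
  have c: "A *\<^sub>v x \<in> carrier_vec n" "A *\<^sub>v y \<in> carrier_vec n" "t \<cdot>\<^sub>v y \<in> carrier_vec n"
    "t \<cdot>\<^sub>v (A *\<^sub>v y) \<in> carrier_vec n"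
    using A x y by auto
  have 1: "A *\<^sub>v (x + t \<cdot>\<^sub>v y) = A *\<^sub>v x + t \<cdot>\<^sub>v (A *\<^sub>v y)"
    using A x y c by (simp add: mult_add_distrib_mat_vec mult_mat_vec)
  show ?thesis
    unfolding 1 using c x y form_commute[OF A sym y x]
    by (simp add: add_scalar_prod_distrib[of _ n] scalar_prod_add_distrib[of _ n]
        power2_eq_square algebra_simps)
qed

lemma finite_quadratic_sublevel:
  fixes A :: "real Matrix.mat" and b :: "real Matrix.vec"
  assumes A: "A \<in> carrier_mat n n"
    and sym: "\<And>i j. i < n \<Longrightarrow> j < n \<Longrightarrow> A $$ (i, j) = A $$ (j, i)"
    and pos: "\<And>x. x \<in> carrier_vec n \<Longrightarrow> x \<noteq> 0\<^sub>v n \<Longrightarrow> x \<bullet> (A *\<^sub>v x) > 0"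
    and b: "b \<in> carrier_vec n"
  shows "finite {x \<in> carrier_vec n. map_vec real_of_int x \<bullet> (A *\<^sub>v map_vec real_of_int x) +
           map_vec real_of_int x \<bullet> b \<le> c}"
proof -
  let ?r = "map_vec real_of_int"
  define Q where "Q x = x \<bullet> (A *\<^sub>v x)" for x
  have "Determinant.det A \<noteq> 0"
  proof
    assume "Determinant.det A = 0"
    then obtain v where v: "v \<in> carrier_vec n" "v \<noteq> 0\<^sub>v n" "A *\<^sub>v v = 0\<^sub>v n"
      using det_0_iff_vec_prod_zero[OF A] by auto
    then show False using pos[of v] by simp
  qed
  then have "A \<in> Units (ring_mat TYPE(real) n ())"
    by (rule det_non_zero_imp_unit[OF A])
  then obtain B where B: "B \<in> carrier_mat n n" "A * B = 1\<^sub>m n"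
    by (auto simp: Units_def ring_mat_def)
  have AB: "A *\<^sub>v (B *\<^sub>v y) = y" if "y \<in> carrier_vec n" for y
    using assoc_mult_mat_vec[OF A B(1) that] B(2) that by simp
  have coord: "\<exists>C. \<forall>x \<in> carrier_vec n. (x $ i)\<^sup>2 \<le> C * Q x" if i: "i < n" for i
  proof -
    define y where "y = B *\<^sub>v unit_vec n i"
    have y: "y \<in> carrier_vec n" and Ay: "A *\<^sub>v y = unit_vec n i"
      using B AB by (auto simp: y_def)
    have "y \<noteq> 0\<^sub>v n"
    proof
      assume "y = 0\<^sub>v n"
      moreover have "A *\<^sub>v 0\<^sub>v n = 0\<^sub>v n" using A by (intro eq_vecI) auto
      ultimately have "unit_vec n i = (0\<^sub>v n :: real Matrix.vec)" using Ay by simp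
      then have "(unit_vec n i :: real Matrix.vec) $ i = 0\<^sub>v n $ i" by simp
      then show False using i by simp
    qed
    then have Qy: "Q y > 0" using pos[OF y] by (simp add: Q_def)
    have "(x $ i)\<^sup>2 \<le> Q y * Q x" if x: "x \<in> carrier_vec n" for x
    proof -
      define t where "t = - (x $ i) / Q y"
      have nn: "Q z \<ge> 0" if "z \<in> carrier_vec n" for z
        using pos[OF that] A by (cases "z = 0\<^sub>v n") (auto simp: Q_def)
      have "0 \<le> Q (x + t \<cdot>\<^sub>v y)" using nn x y by simp
      also have "\<dots> = Q x + 2 * t * (x $ i) + t\<^sup>2 * Q y"
        unfolding Q_def using quadratic_expand[OF A sym x y, of t] x i Ay by simp
      also have "\<dots> = Q x - (x $ i)\<^sup>2 / Q y"
        using Qy by (simp add: t_def power2_eq_square field_simps)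
      finally show ?thesis using Qy by (simp add: field_simps)
    qed
    then show ?thesis by blast
  qed
  define y where "y = B *\<^sub>v b"
  have y: "y \<in> carrier_vec n" and Ay: "A *\<^sub>v y = b" using B AB b by (auto simp: y_def)
  have "\<exists>K. \<forall>x \<in> carrier_vec n. Q (?r x) + ?r x \<bullet> b \<le> c \<longrightarrow> x $ i \<in> {- K..K}" if i: "i < n" for i
  proof -
    obtain C where C: "\<And>x. x \<in> carrier_vec n \<Longrightarrow> (x $ i)\<^sup>2 \<le> C * Q x" using coord[OF i] by blast
    define D where "D = \<bar>C\<bar> * \<bar>c + Q y / 4\<bar>"
    define K where "K = \<lceil>D + 1 + \<bar>y $ i\<bar>\<rceil>"
    have "x $ i \<in> {- K..K}" if x: "x \<in> carrier_vec n" and le: "Q (?r x) + ?r x \<bullet> b \<le> c" for x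
    proof -
      have rx: "?r x \<in> carrier_vec n" using x by simp
      let ?z = "?r x + (1/2) \<cdot>\<^sub>v y"
      have Qz: "Q ?z = Q (?r x) + ?r x \<bullet> b + Q y / 4"
        unfolding Q_def using quadratic_expand[OF A sym rx y, of "1/2"] Ay
        by (simp add: power2_eq_square)
      have z: "?z \<in> carrier_vec n" using rx y by simp
      have Qzn: "0 \<le> Q ?z"
        using pos[OF z] A by (cases "?z = 0\<^sub>v n") (auto simp: Q_def)
      have "(?z $ i)\<^sup>2 \<le> C * Q ?z" by (rule C[OF z])
      also have "\<dots> \<le> \<bar>C\<bar> * Q ?z" using Qzn by (intro mult_right_mono) auto
      also have "\<dots> \<le> D" unfolding D_def using Qz le by (intro mult_left_mono) auto
      finally have sq: "(?z $ i)\<^sup>2 \<le> D" .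
      have "\<bar>?z $ i\<bar> \<le> D + 1"
      proof -
        have "0 \<le> (\<bar>?z $ i\<bar> - 1)\<^sup>2" by simp
        also have "\<dots> = (?z $ i)\<^sup>2 - 2 * \<bar>?z $ i\<bar> + 1" by (simp add: power2_diff)
        finally have "2 * \<bar>?z $ i\<bar> \<le> D + 1" using sq by linarith
        moreover have "0 \<le> \<bar>?z $ i\<bar>" by simp
        ultimately show ?thesis by linarith
      qed
      moreover have "?z $ i = real_of_int (x $ i) + y $ i / 2" using x y i by simp
      ultimately have "\<bar>real_of_int (x $ i)\<bar> \<le> D + 1 + \<bar>y $ i\<bar>" by linarith
      also have "\<dots> \<le> real_of_int K" unfolding K_def by (rule le_of_int_ceiling)
      finally show ?thesis by simp linarith
    qed
    then show ?thesis by blast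
  qed
  then obtain K where K: "\<And>i x. i < n \<Longrightarrow> x \<in> carrier_vec n \<Longrightarrow> Q (?r x) + ?r x \<bullet> b \<le> c \<Longrightarrow>
      x $ i \<in> {- K i..K i}"
    by metis
  have "{x \<in> carrier_vec n. Q (?r x) + ?r x \<bullet> b \<le> c} \<subseteq>
      (\<lambda>f. Matrix.vec n f) ` (\<Pi>\<^sub>E i\<in>{..<n}. {- K i..K i})"
  proof
    fix x assume "x \<in> {x \<in> carrier_vec n. Q (?r x) + ?r x \<bullet> b \<le> c}"
    then have x: "x \<in> carrier_vec n" "Q (?r x) + ?r x \<bullet> b \<le> c" by auto
    then have "x = Matrix.vec n (restrict (\<lambda>i. x $ i) {..<n})" by (intro eq_vecI) auto
    moreover have "restrict (\<lambda>i. x $ i) {..<n} \<in> (\<Pi>\<^sub>E i\<in>{..<n}. {- K i..K i})"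
      using K x by auto
    ultimately show "x \<in> (\<lambda>f. Matrix.vec n f) ` (\<Pi>\<^sub>E i\<in>{..<n}. {- K i..K i})" by blast
  qed
  then show ?thesis
    unfolding Q_def by (rule finite_subset) (intro finite_imageI finite_PiE; simp)
qed

lemma finite_form_sublevel:
  assumes nd: "negative_definite G" and b: "b \<in> carrier_vec (nverts G)"
  shows "finite {x \<in> carrier_vec (nverts G). rat_of_int (x \<bullet> b) - of_int (form G x x) \<le> c}"
proof -
  let ?n = "nverts G" and ?r = "map_vec real_of_int"
  let ?M = "map_mat real_of_int (plumbing_matrix G)"
  have M: "?M \<in> carrier_mat ?n ?n" by simp
  have neg: "x \<bullet> ((- ?M) *\<^sub>v x) = - (x \<bullet> (?M *\<^sub>v x))" if "x \<in> carrier_vec ?n" for x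
  proof -
    have "dim_vec x = dim_col ?M" "dim_vec x = dim_vec (?M *\<^sub>v x)"
      using that carrier_matD[OF plumbing_matrix_carrier[of G]] by auto
    then show ?thesis by (simp only: uminus_mult_mat_vec scalar_prod_uminus_right)
  qed
  have fin: "finite {x \<in> carrier_vec ?n. ?r x \<bullet> ((- ?M) *\<^sub>v ?r x) + ?r x \<bullet> ?r b \<le> real_of_rat c}"
  proof (rule finite_quadratic_sublevel)
    show "- ?M \<in> carrier_mat ?n ?n" using M by simp
    show "(- ?M) $$ (i, j) = (- ?M) $$ (j, i)" if "i < ?n" "j < ?n" for i j
      using that carrier_matD[OF plumbing_matrix_carrier[of G]]
      by (simp add: symmetric_plumbing_matrix[of i G j])
    show "x \<bullet> ((- ?M) *\<^sub>v x) > 0" if "x \<in> carrier_vec ?n" "x \<noteq> 0\<^sub>v ?n" for x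
      using nd that by (simp add: neg negative_definite_def)
    show "?r b \<in> carrier_vec ?n" using b by simp
  qed
  have eq: "?r x \<bullet> ((- ?M) *\<^sub>v ?r x) + ?r x \<bullet> ?r b =
      real_of_rat (rat_of_int (x \<bullet> b) - of_int (form G x x))" if x: "x \<in> carrier_vec ?n" for x
  proof -
    have "?M *\<^sub>v ?r x = ?r (plumbing_matrix G *\<^sub>v x)"
      using x by (simp add: of_int_hom.mult_mat_vec_hom[of _ ?n ?n])
    moreover have hom: "?r x \<bullet> ?r y = real_of_int (x \<bullet> y)" if "dim_vec x = dim_vec y"
      for x y :: "int Matrix.vec"
      using that by (simp add: scalar_prod_def)
    moreover have "?r x \<bullet> ?r (plumbing_matrix G *\<^sub>v x) = real_of_int (form G x x)"
      unfolding form_def using x carrier_matD[OF plumbing_matrix_carrier[of G]]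
      by (intro hom) simp
    moreover have "?r x \<bullet> ?r b = real_of_int (x \<bullet> b)"
      using x b by (intro hom) simp
    ultimately show ?thesis using x by (simp add: neg of_rat_diff)
  qed
  show ?thesis
    by (rule finite_subset[OF _ fin]) (auto simp: eq of_rat_less_eq)
qed

lemma finite_chi_sublevel:
  assumes "negative_definite G" and k: "k \<in> carrier_vec (nverts G)"
  shows "finite {x \<in> carrier_vec (nverts G). chi G k x \<le> c}"
proof -
  have *: "x \<bullet> k = k \<bullet> x" if "x \<in> carrier_vec (nverts G)" for x
    using comm_scalar_prod[OF k that] by simp
  show ?thesis
    by (rule finite_subset[OF _ finite_form_sublevel[OF assms(1), of "- k" "2 * c"]])
      (use k in \<open>auto simp: chi_def * field_simps\<close>)
qed

lemma finite_eps_sublevel: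
  assumes "negative_definite G" and k: "k \<in> carrier_vec (nverts G)"
  shows "finite {x \<in> carrier_vec (nverts G). eps G k x \<le> c}"
proof -
  let ?u = "plumbing_matrix G *\<^sub>v ones G"
  have u: "?u \<in> carrier_vec (nverts G)" by (simp add: mult_mat_vec_carrier[of _ _ "nverts G"])
  have *: "x \<bullet> (?u - k) = form G x (ones G) - k \<bullet> x" if x: "x \<in> carrier_vec (nverts G)" for x
    using scalar_prod_minus_distrib[OF x u k] comm_scalar_prod[OF k x] by (simp add: form_def)
  show ?thesis
    by (rule finite_subset[OF _ finite_form_sublevel[OF assms(1), of "?u - k" "c - Delta G k"]])
      (use k u in \<open>auto simp: eps_def chi_def * field_simps\<close>)
qed

lemma char_vecs_carrier: "k \<in> char_vecs G \<Longrightarrow> k \<in> carrier_vec (nverts G)"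
  by (auto simp: char_vecs_def)

lemma eventual_valueI:
  assumes "F \<noteq> bot" "\<forall>\<^sub>F n in F. f n = c"
  shows "eventual_value F f = c"
  unfolding eventual_value_def
proof (rule the_equality)
  fix c' assume "\<forall>\<^sub>F n in F. f n = c'"
  then have "\<forall>\<^sub>F n in F. c' = c" using assms(2) by eventually_elim simp
  then show "c' = c" using assms(1) by (simp add: eventually_const_iff)
qed fact

lemma partial_series_eventually:
  assumes nd: "negative_definite G" and k: "k \<in> char_vecs G"
  shows "\<forall>\<^sub>F n in at_top. Poly_Mapping.lookup (partial_series G k n) (e, f) =
    (\<Sum>x | x \<in> carrier_vec (nverts G) \<and> eps G k x = e \<and> theta G k x = f. Fhat_graph G k x)"
proof -
  have kc: "k \<in> carrier_vec (nverts G)" using char_vecs_carrier[OF k] .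
  define S where "S = {x. x \<in> carrier_vec (nverts G) \<and> eps G k x = e \<and> theta G k x = f}"
  have S: "finite S"
    by (rule finite_subset[OF _ finite_eps_sublevel[OF nd kc, of e]]) (auto simp: S_def)
  have "\<forall>\<^sub>F n in at_top. chi G k x \<le> of_int n" for x
    unfolding eventually_at_top_linorder
    by (rule exI[of _ "\<lceil>chi G k x\<rceil>"]) (simp add: ceiling_le_iff)
  then have "\<forall>\<^sub>F n in at_top. \<forall>x \<in> S. chi G k x \<le> of_int n"
    using S by (simp add: eventually_ball_finite)
  then show ?thesis
  proof eventually_elim
    case (elim n)
    have "Poly_Mapping.lookup (partial_series G k n) (e, f) =
      (\<Sum>x \<in> {x \<in> carrier_vec (nverts G). chi G k x \<le> of_int n}.
         if x \<in> S then Fhat_graph G k x else 0)"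
      unfolding partial_series_def lookup_sum
      by (intro sum.cong refl) (auto simp: S_def lookup_single when_def)
    also have "\<dots> = (\<Sum>x \<in> S. Fhat_graph G k x)"
      using elim finite_chi_sublevel[OF nd kc]
      by (subst sum.inter_restrict[symmetric]) (auto simp: S_def intro!: sum.cong)
    finally show ?case by (simp add: S_def)
  qed
qed

corollary two_variable_series_eq:
  assumes "negative_definite G" "k \<in> char_vecs G"
  shows "two_variable_series G k (e, f) =
    (\<Sum>x | x \<in> carrier_vec (nverts G) \<and> eps G k x = e \<and> theta G k x = f. Fhat_graph G k x)"
  unfolding two_variable_series_def
  by (rule eventual_valueI[OF _ partial_series_eventually[OF assms]]) simp

lemma finite_support_two_variable_series:
  assumes nd: "negative_definite G" and k: "k \<in> char_vecs G"
  shows "finite {f. two_variable_series G k (e, f) \<noteq> 0}"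
proof (rule finite_subset)
  show "{f. two_variable_series G k (e, f) \<noteq> 0} \<subseteq>
      theta G k ` {x \<in> carrier_vec (nverts G). eps G k x \<le> e}"
    by (force simp: two_variable_series_eq[OF assms] dest: sum.not_neutral_contains_not_neutral)
  show "finite (theta G k ` {x \<in> carrier_vec (nverts G). eps G k x \<le> e})"
    using finite_eps_sublevel[OF nd char_vecs_carrier[OF k]] by simp
qed

lemma mat_inverse_plumbing_matrix:
  assumes nd: "negative_definite G"
  obtains B where "mat_inverse (map_mat rat_of_int (plumbing_matrix G)) = Some B"
    "B \<in> carrier_mat (nverts G) (nverts G)"
    "map_mat rat_of_int (plumbing_matrix G) * B = 1\<^sub>m (nverts G)"
    "B * map_mat rat_of_int (plumbing_matrix G) = 1\<^sub>m (nverts G)"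
proof -
  let ?n = "nverts G" and ?M = "map_mat rat_of_int (plumbing_matrix G)"
    and ?R = "map_mat real_of_int (plumbing_matrix G)"
  have M: "?M \<in> carrier_mat ?n ?n" and R: "?R \<in> carrier_mat ?n ?n" by simp_all
  have "Determinant.det ?R \<noteq> 0"
  proof
    assume "Determinant.det ?R = 0"
    then obtain v where "v \<in> carrier_vec ?n" "v \<noteq> 0\<^sub>v ?n" "?R *\<^sub>v v = 0\<^sub>v ?n"
      using det_0_iff_vec_prod_zero[OF R] by auto
    then show False using nd unfolding negative_definite_def by force
  qed
  then have "Determinant.det ?M \<noteq> 0" by (simp add: of_int_hom.hom_det)
  then have "?M \<in> Units (ring_mat TYPE(rat) ?n ())" by (rule det_non_zero_imp_unit[OF M])
  then obtain B where B: "mat_inverse ?M = Some B"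
    using mat_inverse(1)[OF M, where b = "()"] by blast
  with mat_inverse(2)[OF M B] that show thesis by blast
qed

lemma inv_square_lattice:
  assumes nd: "negative_definite G"
    and a: "a \<in> carrier_vec (nverts G)" and x: "x \<in> carrier_vec (nverts G)"
  shows "inv_square G (a + 2 \<cdot>\<^sub>v (plumbing_matrix G *\<^sub>v x)) =
    inv_square G a + 4 * of_int (x \<bullet> a) + 4 * of_int (form G x x)"
proof -
  let ?n = "nverts G" and ?M = "map_mat rat_of_int (plumbing_matrix G)" and ?q = "map_vec rat_of_int"
  obtain B where inv: "mat_inverse ?M = Some B" and B: "B \<in> carrier_mat ?n ?n"
    and MB: "?M * B = 1\<^sub>m ?n" and BM: "B * ?M = 1\<^sub>m ?n"
    by (rule mat_inverse_plumbing_matrix[OF nd])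
  have M: "?M \<in> carrier_mat ?n ?n" by simp
  have M': "plumbing_matrix G *\<^sub>v x \<in> carrier_vec ?n"
    using x by (rule mult_mat_vec_carrier[rotated]) simp
  have c: "?q a \<in> carrier_vec ?n" "?q x \<in> carrier_vec ?n" "?M *\<^sub>v ?q x \<in> carrier_vec ?n"
    "B *\<^sub>v ?q a \<in> carrier_vec ?n"
    using a x B M by (auto intro!: mult_mat_vec_carrier)
  have hom: "?q y \<bullet> ?q z = rat_of_int (y \<bullet> z)" if "dim_vec y = dim_vec z" for y z
    using that by (simp add: scalar_prod_def)
  have Mx: "?q (plumbing_matrix G *\<^sub>v x) = ?M *\<^sub>v ?q x"
    using x by (simp add: of_int_hom.mult_mat_vec_hom[of _ ?n ?n])
  have l: "?q (a + 2 \<cdot>\<^sub>v (plumbing_matrix G *\<^sub>v x)) = ?q a + 2 \<cdot>\<^sub>v (?M *\<^sub>v ?q x)"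
    unfolding Mx[symmetric] using a M' carrier_matD[OF plumbing_matrix_carrier[of G]]
    by (intro eq_vecI) auto
  have BMx: "B *\<^sub>v (?M *\<^sub>v ?q x) = ?q x"
    using assoc_mult_mat_vec[OF B M c(2)] BM c by simp
  have MBa: "?M *\<^sub>v (B *\<^sub>v ?q a) = ?q a"
    using assoc_mult_mat_vec[OF M B c(1)] MB c by simp
  have Bl: "B *\<^sub>v (?q a + 2 \<cdot>\<^sub>v (?M *\<^sub>v ?q x)) = B *\<^sub>v ?q a + 2 \<cdot>\<^sub>v ?q x"
    using B c by (simp add: mult_add_distrib_mat_vec[of _ ?n ?n] mult_mat_vec[of _ ?n ?n] BMx)
  have sym: "?M $$ (i, j) = ?M $$ (j, i)" if "i < ?n" "j < ?n" for i j
    using that carrier_matD[OF plumbing_matrix_carrier[of G]]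
    by (simp add: symmetric_plumbing_matrix[of i G j])
  have 1: "(?M *\<^sub>v ?q x) \<bullet> (B *\<^sub>v ?q a) = rat_of_int (x \<bullet> a)"
    using form_commute[OF M sym c(4) c(2)] comm_scalar_prod[OF c(3,4)] x a
    by (simp add: MBa hom)
  have 2: "?q a \<bullet> ?q x = rat_of_int (x \<bullet> a)"
    using x a comm_scalar_prod[OF c(1,2)] by (simp add: hom)
  have 3: "(?M *\<^sub>v ?q x) \<bullet> ?q x = rat_of_int (form G x x)"
    using comm_scalar_prod[OF c(3,2)] x M' carrier_matD[OF plumbing_matrix_carrier[of G]]
    by (simp add: Mx[symmetric] hom form_def)
  show ?thesis
    unfolding inv_square_def inv l option.sel Bl using c 1 2 3
    by (simp add: add_scalar_prod_distrib[of _ ?n] scalar_prod_add_distrib[of _ ?n] algebra_simps)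
qed

lemma finite_GPPV_exponent:
  assumes nd: "negative_definite G" and a: "a \<in> carrier_vec (nverts G)"
  shows "finite {l \<in> lattice_class G a. - normalization G - inv_square G l / 4 = e}"
proof (rule finite_subset)
  let ?S = "{x \<in> carrier_vec (nverts G).
    rat_of_int (x \<bullet> (- a)) - of_int (form G x x) \<le> e + normalization G + inv_square G a / 4}"
  show "{l \<in> lattice_class G a. - normalization G - inv_square G l / 4 = e} \<subseteq>
      (\<lambda>x. a + 2 \<cdot>\<^sub>v (plumbing_matrix G *\<^sub>v x)) ` ?S"
    using a by (auto simp: lattice_class_def inv_square_lattice[OF nd a] field_simps)
  show "finite ((\<lambda>x. a + 2 \<cdot>\<^sub>v (plumbing_matrix G *\<^sub>v x)) ` ?S)"
    using finite_form_sublevel[OF nd, of "- a"] a by simp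
qed

end

theory Submission
  imports Defs
begin

text \<open>
  In terms of \<open>l = k - M u + 2 M x\<close> all data of a term of the two-variable series take a simple form:
  the coefficient is the product of the \<open>Fhat\<close> of the vertex degrees at the entries of \<open>l\<close>, the
  exponent of \<open>q\<close> is a constant of the plumbing minus \<open>l\<^sup>2 / 4\<close>, where \<open>l\<^sup>2\<close> is the value
  of the inverse form at \<open>l\<close>, and the exponent of \<open>t\<close> is half the sum of the entries of \<open>l\<close>.  When \<open>x\<close> runs over the lattice, \<open>l\<close> runs once over the coset
  \<open>k - M u + 2 M\<int>\<^sup>s\<close>, because \<open>M\<close> is nondegenerate.  So the series is a sum over this coset
  (\<open>two_variable_series_eq_lattice_series\<close>), and it does not depend on the representative \<open>k\<close>.

  At \<open>t = 1\<close> this is literally the sum that defines the GPPV series, once the principal value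
  integrals are known to be the numbers \<open>Fhat\<close> (\<open>pv_integral_eq_Fhat\<close>).  That holds because
  the integrals over the two circles read off coefficients of the two expansions of
  \<open>(z - 1/z)\<^bsup>2 - n\<^esup>\<close>, by termwise integration.

  For a blow-up let \<open>D\<close> be the indicator vector of the neighbours of the new vertex.  The vectors of
  the new coset are \<open>(-s, l + s D)\<close> with \<open>l\<close> in the old coset and \<open>s\<close> of a fixed parity, and the
  square of such a vector is \<open>l\<^sup>2 - s\<^sup>2\<close>.  For type (a) the new vertex has degree \<open>2\<close>, its
  factor is non-zero only for \<open>s = 0\<close>, and terms correspond one to one.  For type (b) it is a leaf,
  its factor is \<open>1\<close> for \<open>s = 1\<close>, \<open>-1\<close> for \<open>s = -1\<close> and \<open>0\<close> otherwise, and both vectors have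
  the exponents of \<open>l\<close>.  At the neighbour, of degree \<open>n\<close> before the move, the two terms combine by
  \<open>Fhat (n + 1) (r + 1) - Fhat (n + 1) (r - 1) = Fhat n r\<close> (\<open>Fhat_Suc_diff\<close>).  Blow-ups
  moreover preserve and reflect negative definiteness, so the equality of the series passes along
  every chain of moves and their inverses.
\<close>

section \<open>The family of coefficient functions\<close>

text \<open>
  The power series \<open>\<Sum> w\<^sup>j\<close> over odd \<open>j\<close>, that is \<open>w / (1 - w\<^sup>2)\<close>.  It expands
  \<open>- 1 / (z - 1/z)\<close> at \<open>w = z\<close> and \<open>1 / (z - 1/z)\<close> at \<open>w = 1/z\<close>.
\<close>

definition odd_fps :: "'a::field fps" where
  "odd_fps = Abs_fps (\<lambda>j. if odd j then 1 else 0)"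

lemma odd_series_nth: "fls_nth odd_series n = (if n \<ge> 0 \<and> odd n then 1 else 0)"
  by (auto simp: odd_series_def even_nat_iff)

lemma fls_nth_odd_series_power:
  "fls_nth (odd_series ^ m) n = (if n < 0 then 0 else fps_nth (odd_fps ^ m) (nat n))"
  by (simp add: odd_series_def odd_fps_def flip: fps_to_fls_power)

lemma odd_series_inverse: "(fls_X - fls_X_inv) * odd_series = -1"
proof (rule fls_eqI)
  fix n :: int
  show "fls_nth ((fls_X - fls_X_inv) * odd_series) n = fls_nth (-1) n"
    by (auto simp: left_diff_distrib fls_X_times_conv_shift fls_X_inv_times_conv_shift
        odd_series_nth)
qed

lemma fls_nth_X_minus_X_inv_times:
  "fls_nth ((fls_X - fls_X_inv) * g) n = fls_nth g (n - 1) - fls_nth g (n + 1)"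
  for g :: "'a::ring_1 fls"
  by (simp add: left_diff_distrib fls_X_times_conv_shift fls_X_inv_times_conv_shift)

text \<open>
  For \<open>n = 2\<close> both expansions are the constant \<open>1\<close>, so the formula for \<open>n \<ge> 3\<close> holds there as
  well.
\<close>

lemma Fhat_ge_2:
  assumes "n \<ge> 2"
  shows "Fhat n r = (fls_nth ((- odd_series) ^ (n - 2)) (- r) + fls_nth (odd_series ^ (n - 2)) r) / 2"
proof (cases "n = 2")
  case True
  then show ?thesis by (simp add: Fhat_def)
qed (use assms in \<open>simp add: Fhat_def\<close>)

lemma Fhat_2: "Fhat 2 r = (if r = 0 then 1 else 0)"
  by (simp add: Fhat_def)

lemma Fhat_1: "Fhat 1 r = (if r = 1 then -1 else if r = -1 then 1 else 0)"
  by (auto simp: Fhat_def)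

lemma Fhat_0: "Fhat 0 r = (if r = 2 then 1 else if r = 0 then -2 else if r = -2 then 1 else 0)"
  by (auto simp: Fhat_def power2_eq_square fls_nth_X_minus_X_inv_times)

text \<open>
  Multiplication by \<open>z - 1/z\<close> turns \<open>(z - 1/z)\<^bsup>1 - n\<^esup>\<close> into \<open>(z - 1/z)\<^bsup>2 - n\<^esup>\<close>, in the Laurent
  polynomials as in both expansions.  Type (b) moves need this at the neighbour of the new leaf.
\<close>

lemma Fhat_Suc_diff: "Fhat (Suc n) (r + 1) - Fhat (Suc n) (r - 1) = Fhat n r"
proof (cases "n \<ge> 2")
  case False
  then have "2 - n = Suc (2 - Suc n)" by simp
  then show ?thesis
    using False by (simp add: Fhat_def fls_nth_X_minus_X_inv_times)
next
  case True
  then have e: "n - Suc 0 = Suc (n - 2)" by simp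
  have 1: "(fls_X - fls_X_inv) * (- odd_series) ^ Suc m = (- odd_series) ^ m" for m
    by (simp add: mult.assoc[symmetric] odd_series_inverse)
  \<comment> \<open>The variable is now the inverse of \<open>z\<close>, which changes the sign of \<open>z - 1/z\<close>.\<close>
  have 2: "(fls_X - fls_X_inv) * odd_series ^ Suc m = - (odd_series ^ m)" for m
    by (simp add: mult.assoc[symmetric] odd_series_inverse)
  show ?thesis
    using True arg_cong[OF 1[of "n - 2"], of "\<lambda>f. fls_nth f (- r)"]
      arg_cong[OF 2[of "n - 2"], of "\<lambda>f. fls_nth f r"]
    unfolding fls_nth_X_minus_X_inv_times
    by (simp add: Fhat_ge_2 e del: power_Suc) (simp add: field_simps del: power_Suc)
qed

section \<open>Principal value integrals\<close>

lemma has_contour_integral_powi_circlepath: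
  assumes "R > 0"
  shows "((\<lambda>z. z powi k) has_contour_integral (if k = -1 then 2 * of_real pi * \<i> else 0)) (circlepath 0 R)"
proof (cases "k = -1")
  case True
  have "((\<lambda>w. 1 / (w - 0)) has_contour_integral 2 * of_real pi * \<i>) (circlepath 0 R)"
    using contour_integral_circlepath[OF assms, of 0] has_contour_integral_integral
      not_integrable_contour_integral pi_neq_zero complex_i_not_zero
    by (metis (no_types, lifting) mult_eq_0_iff of_real_eq_0_iff zero_neq_numeral)
  then show ?thesis using True by (simp add: power_int_minus divide_inverse)
next
  case False
  have "((\<lambda>z. z powi k) has_contour_integral
      (\<lambda>z. z powi (k + 1) / of_int (k + 1)) (pathfinish (circlepath 0 R)) -
      (\<lambda>z. z powi (k + 1) / of_int (k + 1)) (pathstart (circlepath 0 R))) (circlepath 0 R)"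
  proof (rule contour_integral_primitive)
    show "path_image (circlepath 0 R) \<subseteq> - {0}" using assms by auto
    have nz: "of_int (k + 1) \<noteq> (0::complex)" using False by (metis add.inverse_unique add.commute of_int_eq_0_iff)
    show "((\<lambda>z. z powi (k + 1) / of_int (k + 1)) has_field_derivative z powi k) (at z within - {0})"
      if "z \<in> - {0}" for z :: complex
      using that nz by (auto intro!: derivative_eq_intros)
  qed simp
  then show ?thesis using False by simp
qed

text \<open>
  Termwise integration: a series of powers that converges normally on a circle about \<open>0\<close> picks
  out the coefficients of exponent \<open>-1\<close>.
\<close>

lemma contour_integral_circlepath_suminf_powi:
  fixes c :: "nat \<Rightarrow> complex" and s :: "nat \<Rightarrow> int"
  assumes R: "R > 0" and sum: "summable (\<lambda>j. norm (c j) * R powi s j)"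
    and f: "\<And>z. norm z = R \<Longrightarrow> (\<lambda>j. c j * z powi s j) sums f z"
  shows "(\<lambda>j. if s j = -1 then c j else 0) sums (contour_integral (circlepath 0 R) f / (2 * of_real pi * \<i>))"
proof -
  let ?C = "2 * of_real pi * \<i>"
  let ?p = "\<lambda>n z. \<Sum>j<n. c j * z powi s j"
  have int: "(?p n has_contour_integral (\<Sum>j<n. c j * (if s j = -1 then ?C else 0))) (circlepath 0 R)" for n
    by (intro has_contour_integral_sum has_contour_integral_lmul has_contour_integral_powi_circlepath R) simp
  have "uniform_limit (sphere 0 R) ?p (\<lambda>z. suminf (\<lambda>j. c j * z powi s j)) sequentially"
    by (rule Weierstrass_m_test[OF _ sum]) (simp add: norm_mult norm_power_int)
  also have "?this \<longleftrightarrow> uniform_limit (sphere 0 R) ?p f sequentially"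
    by (rule uniform_limit_cong') (use f in \<open>auto simp: sums_iff\<close>)
  finally have "(\<lambda>n. contour_integral (circlepath 0 R) (?p n)) \<longlonglongrightarrow> contour_integral (circlepath 0 R) f"
    using int R by (intro contour_integral_uniform_limit_circlepath(2))
      (auto intro!: always_eventually has_contour_integral_integrable)
  then have "(\<lambda>j. c j * (if s j = -1 then ?C else 0)) sums contour_integral (circlepath 0 R) f"
    by (simp add: sums_def contour_integral_unique[OF int])
  then have "(\<lambda>j. c j * (if s j = -1 then ?C else 0) / ?C) sums (contour_integral (circlepath 0 R) f / ?C)"
    by (rule sums_divide)
  also have "(\<lambda>j. c j * (if s j = -1 then ?C else 0) / ?C) = (\<lambda>j. if s j = -1 then c j else 0)"
    by auto
  finally show ?thesis .
qed

lemma fps_conv_radius_odd_fps: "fps_conv_radius (odd_fps :: complex fps) \<ge> 1"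
  unfolding fps_conv_radius_def
proof (rule conv_radius_geI_ex')
  fix r :: real assume r: "0 < r" "ereal r < 1"
  show "summable (\<lambda>n. fps_nth (odd_fps :: complex fps) n * of_real r ^ n)"
    by (rule summable_comparison_test'[where g = "\<lambda>n. r ^ n" and N = 0])
       (use r in \<open>auto simp: odd_fps_def norm_power intro: summable_geometric\<close>)
qed

lemma one_minus_power2_neq_0:
  fixes w :: complex
  assumes "norm w < 1"
  shows "1 - w\<^sup>2 \<noteq> 0"
  using assms power2_eq_1_iff[of w] by auto

lemma eval_odd_fps:
  fixes w :: complex
  assumes "norm w < 1"
  shows "eval_fps odd_fps w = w / (1 - w\<^sup>2)"
proof -
  have w: "norm w < fps_conv_radius (odd_fps :: complex fps)"
    using less_le_trans[OF _ fps_conv_radius_odd_fps, of "ereal (norm w)"] assms by simp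
  have "fps_nth (odd_fps * (1 - fps_X ^ 2)) j = (fps_nth fps_X j :: complex)" for j
    by (cases "j = 0 \<or> j = 1")
       (auto simp: odd_fps_def right_diff_distrib fps_X_power_mult_right_nth)
  then have "odd_fps * (1 - fps_X ^ 2 :: complex fps) = fps_X"
    by (rule fps_ext)
  then have "eval_fps (odd_fps * (1 - fps_X ^ 2)) w = eval_fps fps_X w" by simp
  moreover have "eval_fps (1 - fps_X ^ 2) w = 1 - w ^ 2"
    by (subst eval_fps_diff) (auto simp: eval_fps_power)
  moreover have "fps_conv_radius (1 - fps_X ^ 2 :: complex fps) = \<infinity>"
    using fps_conv_radius_diff[of 1 "fps_X ^ 2 :: complex fps"] by simp
  ultimately have "eval_fps odd_fps w * (1 - w ^ 2) = w"
    using w by (simp add: eval_fps_mult)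
  then show ?thesis using one_minus_power2_neq_0[OF assms] by (simp add: field_simps)
qed

lemma of_rat_odd_fps_power: "fps_nth (odd_fps ^ m :: 'a::field_char_0 fps) j = of_rat (fps_nth (odd_fps ^ m) j)"
proof (induction m arbitrary: j)
  case (Suc m)
  have "fps_nth odd_fps i = (of_rat (fps_nth odd_fps i) :: 'a)" for i
    by (simp add: odd_fps_def)
  with Suc show ?case
    by (simp add: fps_mult_nth of_rat_sum of_rat_mult)
qed auto

lemma sums_odd_fps_power:
  fixes w :: complex
  assumes "norm w < 1"
  shows "(\<lambda>j. of_rat (fps_nth (odd_fps ^ m) j) * w ^ j) sums (w / (1 - w\<^sup>2)) ^ m"
    and "summable (\<lambda>j. norm (of_rat (fps_nth (odd_fps ^ m) j) :: complex) * norm w ^ j)"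
proof -
  have w1: "norm w < fps_conv_radius (odd_fps :: complex fps)"
    using less_le_trans[OF _ fps_conv_radius_odd_fps, of "ereal (norm w)"] assms by simp
  then have w: "norm w < fps_conv_radius (odd_fps ^ m :: complex fps)"
    using less_le_trans[OF _ fps_conv_radius_power] by blast
  show "(\<lambda>j. of_rat (fps_nth (odd_fps ^ m) j) * w ^ j) sums (w / (1 - w\<^sup>2)) ^ m"
    using sums_eval_fps[OF w] eval_fps_power[OF w1, of m] eval_odd_fps[OF assms]
    by (simp flip: of_rat_odd_fps_power)
  show "summable (\<lambda>j. norm (of_rat (fps_nth (odd_fps ^ m) j) :: complex) * norm w ^ j)"
    using norm_summable_fps[OF w] by (simp add: norm_mult norm_power flip: of_rat_odd_fps_power)
qed

text \<open>
  The integrand for a vertex of degree \<open>n\<close> and an exponent \<open>r\<close>.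
\<close>

definition GPPV_integrand :: "nat \<Rightarrow> int \<Rightarrow> complex \<Rightarrow> complex" where
  "GPPV_integrand n r z = 1 / z * (z - 1 / z) powi (2 - int n) * z powi r"

lemma integral_inner_circle:
  assumes R: "0 < R" "R < 1" and n: "n \<ge> 2"
  shows "contour_integral (circlepath 0 R) (GPPV_integrand n r) =
    2 * of_real pi * \<i> * of_rat (fls_nth ((- odd_series) ^ (n - 2)) (- r))"
proof -
  define m where "m = n - 2"
  have powi_m: "inverse x powi (2 - int n) = x ^ m" for x :: complex
  proof -
    have "2 - int n = - int m" using n by (simp add: m_def)
    then show ?thesis by (simp add: power_int_minus power_inverse)
  qed
  define c :: "nat \<Rightarrow> complex" where "c j = of_rat ((-1) ^ m * fps_nth (odd_fps ^ m) j)" for j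
  \<comment> \<open>Here \<open>\<bar>z\<bar> < 1\<close>: the expansion is in powers of \<open>z\<close>, and \<open>j = - r\<close> is the exponent picked out.\<close>
  have "(\<lambda>j. if int j + (r - 1) = -1 then c j else 0) sums
    (contour_integral (circlepath 0 R) (GPPV_integrand n r) / (2 * of_real pi * \<i>))"
  proof (rule contour_integral_circlepath_suminf_powi[OF R(1)])
    show "summable (\<lambda>j. norm (c j) * R powi (int j + (r - 1)))"
      using summable_mult2[OF sums_odd_fps_power(2)[of "of_real R" m], of "R powi (r - 1)"] R
      by (simp add: c_def power_int_add of_rat_mult norm_mult norm_power of_rat_power mult_ac)
    fix z :: complex assume z: "norm z = R"
    then have z1: "norm z < 1" "z \<noteq> 0" using R by auto
    have z2: "1 - z\<^sup>2 \<noteq> 0" by (rule one_minus_power2_neq_0[OF z1(1)])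
    have *: "z - 1 / z = inverse (- (z / (1 - z\<^sup>2)))"
      using z1 z2 by (simp add: field_simps power2_eq_square)
    have "GPPV_integrand n r z = (- (z / (1 - z\<^sup>2))) ^ m * z powi (r - 1)"
      using z1 unfolding GPPV_integrand_def * powi_m
      by (simp add: power_int_diff)
    then have "GPPV_integrand n r z = (z / (1 - z\<^sup>2)) ^ m * ((-1) ^ m * z powi (r - 1))"
      by (simp add: power_minus[of "z / (1 - z\<^sup>2)"])
    then show "(\<lambda>j. c j * z powi (int j + (r - 1))) sums GPPV_integrand n r z"
      using sums_mult2[OF sums_odd_fps_power(1)[OF z1(1), of m], of "(-1) ^ m * z powi (r - 1)"] z1
      by (simp add: c_def power_int_add of_rat_mult of_rat_power of_rat_minus mult_ac)
  qed
  moreover have "(\<lambda>j. if int j + (r - 1) = -1 then c j else 0) sums (if r > 0 then 0 else c (nat (- r)))"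
  proof (cases "r > 0")
    case False
    then have "int j + (r - 1) = -1 \<longleftrightarrow> j = nat (- r)" for j by auto
    then show ?thesis using False sums_single[of "nat (- r)" c] by (simp cong: if_cong)
  next
    case True
    then have "int j + (r - 1) \<noteq> -1" for j by auto
    then show ?thesis using True by (simp cong: if_cong)
  qed
  ultimately have "contour_integral (circlepath 0 R) (GPPV_integrand n r) / (2 * of_real pi * \<i>) =
    (if r > 0 then 0 else c (nat (- r)))"
    by (rule sums_unique2)
  moreover have "fls_nth ((- odd_series) ^ m) k = (-1) ^ m * fls_nth (odd_series ^ m) k" for k
    by (cases "even m") auto
  ultimately show ?thesis
    by (auto simp: c_def m_def fls_nth_odd_series_power field_simps split: if_splits)
qed

lemma integral_outer_circle:
  assumes R: "R > 1" and n: "n \<ge> 2"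
  shows "contour_integral (circlepath 0 R) (GPPV_integrand n r) =
    2 * of_real pi * \<i> * of_rat (fls_nth (odd_series ^ (n - 2)) r)"
proof -
  define m where "m = n - 2"
  have powi_m: "inverse x powi (2 - int n) = x ^ m" for x :: complex
  proof -
    have "2 - int n = - int m" using n by (simp add: m_def)
    then show ?thesis by (simp add: power_int_minus power_inverse)
  qed
  define c :: "nat \<Rightarrow> complex" where "c j = of_rat (fps_nth (odd_fps ^ m) j)" for j
  \<comment> \<open>Here \<open>\<bar>z\<bar> > 1\<close>: the expansion is in powers of \<open>1/z\<close>, and \<open>j = r\<close> is the exponent picked out.\<close>
  have "(\<lambda>j. if r - 1 - int j = -1 then c j else 0) sums
    (contour_integral (circlepath 0 R) (GPPV_integrand n r) / (2 * of_real pi * \<i>))"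
  proof (rule contour_integral_circlepath_suminf_powi)
    show "R > 0" using R by simp
    show "summable (\<lambda>j. norm (c j) * R powi (r - 1 - int j))"
      using summable_mult2[OF sums_odd_fps_power(2)[of "of_real (inverse R)" m], of "R powi (r - 1)"] R
      by (simp add: c_def power_int_diff[of R "r - 1"] norm_inverse power_inverse divide_inverse inverse_less_1_iff mult_ac)
    fix z :: complex assume z: "norm z = R"
    then have z0: "z \<noteq> 0" using R by auto
    define w where "w = inverse z"
    have w1: "norm w < 1" and w0: "w \<noteq> 0" using z R z0 by (auto simp: w_def norm_inverse inverse_less_1_iff)
    have w2: "1 - w\<^sup>2 \<noteq> 0" by (rule one_minus_power2_neq_0[OF w1])
    have zw: "z = inverse w" by (simp add: w_def)
    have *: "z - 1 / z = inverse (w / (1 - w\<^sup>2))"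
      using w0 w2 unfolding zw by (simp add: field_simps power2_eq_square)
    have "GPPV_integrand n r z = (w / (1 - w\<^sup>2)) ^ m * z powi (r - 1)"
      using z0 unfolding GPPV_integrand_def * powi_m
      by (simp add: power_int_diff)
    then show "(\<lambda>j. c j * z powi (r - 1 - int j)) sums GPPV_integrand n r z"
      using sums_mult2[OF sums_odd_fps_power(1)[OF w1, of m], of "z powi (r - 1)"] z0
      by (simp add: c_def w_def power_int_diff[of z "r - 1"] power_inverse divide_inverse mult_ac)
  qed
  moreover have "(\<lambda>j. if r - 1 - int j = -1 then c j else 0) sums (if r < 0 then 0 else c (nat r))"
  proof (cases "r < 0")
    case False
    then have "r - 1 - int j = -1 \<longleftrightarrow> j = nat r" for j by auto
    then show ?thesis using False sums_single[of "nat r" c] by (simp cong: if_cong)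
  next
    case True
    then have "r - 1 - int j \<noteq> -1" for j by auto
    then show ?thesis using True by (simp cong: if_cong)
  qed
  ultimately have "contour_integral (circlepath 0 R) (GPPV_integrand n r) / (2 * of_real pi * \<i>) =
    (if r < 0 then 0 else c (nat r))"
    by (rule sums_unique2)
  then show ?thesis
    by (auto simp: c_def m_def fls_nth_odd_series_power field_simps split: if_splits)
qed

lemma integral_low_degree:
  assumes R: "R > 0" and n: "n < 2"
  shows "contour_integral (circlepath 0 R) (GPPV_integrand n r) = 2 * of_real pi * \<i> * of_rat (Fhat n r)"
proof -
  let ?i = "\<lambda>k. if k = -1 then 2 * complex_of_real pi * \<i> else 0"
  note P = has_contour_integral_powi_circlepath[OF R]
  have eq: "(g has_contour_integral i) (circlepath 0 R) \<Longrightarrow> (\<And>z. z \<noteq> 0 \<Longrightarrow> g z = GPPV_integrand n r z)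
    \<Longrightarrow> contour_integral (circlepath 0 R) (GPPV_integrand n r) = i" for g i
    using R by (intro contour_integral_unique) (auto elim!: has_contour_integral_eq)
  consider "n = 0" | "n = 1" using n by linarith
  then show ?thesis
  proof cases
    case 1
    have "contour_integral (circlepath 0 R) (GPPV_integrand n r) = ?i (r + 1) - 2 * ?i (r - 1) + ?i (r - 3)"
      by (rule eq[of "\<lambda>z. z powi (r + 1) - 2 * z powi (r - 1) + z powi (r - 3)"],
          (intro has_contour_integral_add has_contour_integral_diff has_contour_integral_lmul P)[1])
         (simp_all add: GPPV_integrand_def 1 power_int_add power_int_diff field_simps power2_eq_square
           power3_eq_cube)
    moreover consider "r = 2" | "r = 0" | "r = -2" | "r \<noteq> 2" "r \<noteq> 0" "r \<noteq> -2" by blast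
    then have "?i (r + 1) - 2 * ?i (r - 1) + ?i (r - 3) = 2 * of_real pi * \<i> * of_rat (Fhat 0 r)"
      by cases (simp_all add: Fhat_0 of_rat_minus)
    ultimately show ?thesis by (simp add: 1)
  next
    case 2
    have "contour_integral (circlepath 0 R) (GPPV_integrand n r) = ?i r - ?i (r - 2)"
      by (rule eq[of "\<lambda>z. z powi r - z powi (r - 2)"], (intro has_contour_integral_diff P)[1])
         (auto simp: GPPV_integrand_def 2 power_int_add power_int_diff field_simps power2_eq_square)
    then show ?thesis by (auto simp: 2 Fhat_1[unfolded One_nat_def] of_rat_minus)
  qed
qed

theorem pv_integral_eq_Fhat:
  "1 / (2 * of_real pi * \<i>) * pv_integral (\<lambda>z. 1 / z * (z - 1 / z) powi (2 - int n) * z powi r) =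
    of_rat (Fhat n r)"
proof -
  have "\<forall>\<^sub>F \<epsilon> in at_right (0::real). \<epsilon> < 1"
    by (rule eventually_at_right_field[THEN iffD2]) (auto intro: exI[of _ 1])
  moreover have "\<forall>\<^sub>F \<epsilon> in at_right (0::real). \<epsilon> > 0"
    by (rule eventually_at_right_less)
  ultimately have "\<forall>\<^sub>F \<epsilon> in at_right (0 :: real).
      (contour_integral (circlepath 0 (1 + \<epsilon>)) (GPPV_integrand n r) +
       contour_integral (circlepath 0 (1 - \<epsilon>)) (GPPV_integrand n r)) / 2 =
      2 * of_real pi * \<i> * of_rat (Fhat n r)"
  proof eventually_elim
    case (elim \<epsilon>)
    show ?case
    proof (cases "n \<ge> 2")
      case True
      then show ?thesis using elim
        by (simp add: integral_inner_circle integral_outer_circle Fhat_ge_2 of_rat_divide of_rat_add algebra_simps add_divide_distrib)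
    next
      case False
      then show ?thesis using elim by (simp add: integral_low_degree)
    qed
  qed
  then have "pv_integral (GPPV_integrand n r) = 2 * of_real pi * \<i> * of_rat (Fhat n r)"
    unfolding pv_integral_def by (intro eventual_valueI) auto
  then show ?thesis
    by (simp add: GPPV_integrand_def[abs_def])
qed

section \<open>The series as a sum over a lattice coset\<close>

text \<open>
  The passage from characteristic vectors to the other parametrization of spin-c structures, by
  vectors congruent to the vertex degrees modulo \<open>2\<close>.
\<close>

abbreviation (input) reduced :: "plumbing \<Rightarrow> int Matrix.vec \<Rightarrow> int Matrix.vec" where
  "reduced G k \<equiv> k - plumbing_matrix G *\<^sub>v ones G"

text \<open>
  The pair of exponents of \<open>q\<close> and \<open>t\<close> that belongs to a vector \<open>l = k - M u + 2 M x\<close>, expressed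
  by \<open>l\<close> alone.
\<close>

definition lattice_exponents :: "plumbing \<Rightarrow> int Matrix.vec \<Rightarrow> rat \<times> rat" where
  "lattice_exponents G l = (- normalization G - inv_square G l / 4, of_int (l \<bullet> ones G) / 2)"

text \<open>
  The coefficient that belongs to \<open>l\<close>.
\<close>

definition lattice_weight :: "plumbing \<Rightarrow> int Matrix.vec \<Rightarrow> rat" where
  "lattice_weight G l = (\<Prod>v < nverts G. Fhat (vertex_degree G v) (l $ v))"

text \<open>
  The sum of the terms of all \<open>l\<close> in a set \<open>L\<close>, as a function of the pair of exponents.  It is
  used for lattice cosets of negative definite plumbings, where only finitely many \<open>l\<close> share a
  pair of exponents.
\<close>

definition lattice_series :: "plumbing \<Rightarrow> int Matrix.vec set \<Rightarrow> rat \<times> rat \<Rightarrow> rat" where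
  "lattice_series G L p = (\<Sum>l | l \<in> L \<and> lattice_exponents G l = p. lattice_weight G l)"

lemma mult_plumbing_matrix_carrier [simp]:
  "plumbing_matrix G *\<^sub>v x \<in> carrier_vec (nverts G)"
  by (auto simp: plumbing_matrix_def intro: carrier_vecI)

lemma dim_plumbing_matrix [simp]:
  "dim_row (plumbing_matrix G) = nverts G" "dim_col (plumbing_matrix G) = nverts G"
  by (simp_all add: plumbing_matrix_def)

lemma form_plumbing_commute:
  assumes "x \<in> carrier_vec (nverts G)" "y \<in> carrier_vec (nverts G)"
  shows "form G x y = form G y x"
  unfolding form_def by (rule form_commute[OF plumbing_matrix_carrier symmetric_plumbing_matrix assms])

lemma eps_eq:
  assumes nd: "negative_definite G" and k: "k \<in> carrier_vec (nverts G)" and x: "x \<in> carrier_vec (nverts G)"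
  shows "eps G k x = - normalization G - inv_square G (reduced G k + 2 \<cdot>\<^sub>v (plumbing_matrix G *\<^sub>v x)) / 4"
proof -
  have "x \<bullet> reduced G k = k \<bullet> x - form G x (ones G)"
    using scalar_prod_minus_distrib[OF x k mult_plumbing_matrix_carrier[of G "ones G"]] comm_scalar_prod[OF x k]
    by (simp add: form_def)
  then show ?thesis
    using inv_square_lattice[OF nd _ x, of "reduced G k"] k
    by (simp add: eps_def Delta_def chi_def field_simps)
qed

lemma theta_eq:
  assumes k: "k \<in> carrier_vec (nverts G)" and x: "x \<in> carrier_vec (nverts G)"
  shows "theta G k x = of_int ((reduced G k + 2 \<cdot>\<^sub>v (plumbing_matrix G *\<^sub>v x)) \<bullet> ones G) / 2"
proof -
  let ?M = "plumbing_matrix G"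
  have "(reduced G k + 2 \<cdot>\<^sub>v (?M *\<^sub>v x)) \<bullet> ones G =
    k \<bullet> ones G - (?M *\<^sub>v ones G) \<bullet> ones G + 2 * ((?M *\<^sub>v x) \<bullet> ones G)"
    using k by (simp add: add_scalar_prod_distrib[of _ "nverts G"] minus_scalar_prod_distrib[of _ "nverts G"]
        smult_scalar_prod_distrib[of _ "nverts G"])
  moreover have "(?M *\<^sub>v y) \<bullet> ones G = form G (ones G) y" for y
    by (simp add: form_def comm_scalar_prod[of _ "nverts G"])
  ultimately show ?thesis
    using form_plumbing_commute[OF x ones_carrier] by (simp add: theta_def Theta_def field_simps)
qed

lemma Fhat_graph_eq:
  assumes k: "k \<in> carrier_vec (nverts G)"
  shows "Fhat_graph G k x = lattice_weight G (reduced G k + 2 \<cdot>\<^sub>v (plumbing_matrix G *\<^sub>v x))"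
  unfolding Fhat_graph_def lattice_weight_def
proof (intro prod.cong refl)
  fix v assume "v \<in> {..<nverts G}"
  then show "Fhat (vertex_degree G v)
      ((2 \<cdot>\<^sub>v (plumbing_matrix G *\<^sub>v x) + k - plumbing_matrix G *\<^sub>v ones G) $ v) =
    Fhat (vertex_degree G v) ((reduced G k + 2 \<cdot>\<^sub>v (plumbing_matrix G *\<^sub>v x)) $ v)"
    using k by (simp add: algebra_simps del: index_mult_mat_vec)
qed

lemma plumbing_matrix_kernel:
  assumes nd: "negative_definite G" and x: "x \<in> carrier_vec (nverts G)"
    and "plumbing_matrix G *\<^sub>v x = 0\<^sub>v (nverts G)"
  shows "x = 0\<^sub>v (nverts G)"
proof (rule ccontr)
  let ?r = "map_vec real_of_int"
  assume "x \<noteq> 0\<^sub>v (nverts G)"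
  then have "?r x \<noteq> 0\<^sub>v (nverts G)" using x by (auto simp: vec_eq_iff)
  then have "?r x \<bullet> (map_mat real_of_int (plumbing_matrix G) *\<^sub>v ?r x) < 0"
    using nd x by (simp add: negative_definite_def)
  also have "map_mat real_of_int (plumbing_matrix G) *\<^sub>v ?r x = ?r (plumbing_matrix G *\<^sub>v x)"
    using x by (simp add: of_int_hom.mult_mat_vec_hom[of _ "nverts G" "nverts G"])
  finally show False using assms(3) x by (simp add: scalar_prod_def)
qed

lemma inj_on_lattice_map:
  assumes nd: "negative_definite G" and a: "a \<in> carrier_vec (nverts G)"
  shows "inj_on (\<lambda>x. a + 2 \<cdot>\<^sub>v (plumbing_matrix G *\<^sub>v x)) (carrier_vec (nverts G))"
proof (rule inj_onI)
  let ?M = "plumbing_matrix G"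
  fix x y :: "int Matrix.vec"
  assume x: "x \<in> carrier_vec (nverts G)" and y: "y \<in> carrier_vec (nverts G)"
    and e: "a + 2 \<cdot>\<^sub>v (?M *\<^sub>v x) = a + 2 \<cdot>\<^sub>v (?M *\<^sub>v y)"
  have "(?M *\<^sub>v x) $ i = (?M *\<^sub>v y) $ i" if "i < nverts G" for i
    using arg_cong[OF e, of "\<lambda>v. v $ i"] a that by (simp del: index_mult_mat_vec)
  then have "?M *\<^sub>v x = ?M *\<^sub>v y" by (intro eq_vecI) auto
  then have "?M *\<^sub>v (x - y) = ?M *\<^sub>v y - ?M *\<^sub>v y"
    by (simp only: mult_minus_distrib_mat_vec[OF plumbing_matrix_carrier x y])
  also have "\<dots> = 0\<^sub>v (nverts G)"
    by (rule minus_cancel_vec) simp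
  finally have "?M *\<^sub>v (x - y) = 0\<^sub>v (nverts G)" .
  then have "x - y = 0\<^sub>v (nverts G)"
    by (rule plumbing_matrix_kernel[OF nd minus_carrier_vec[OF x y]])
  then have "(x - y) $ i = 0" if "i < nverts G" for i using that by (simp del: index_minus_vec)
  then have "x $ i = y $ i" if "i < nverts G" for i using that y by simp
  then show "x = y" using x y by (intro eq_vecI) auto
qed

lemma reduced_carrier [simp]: "k \<in> carrier_vec (nverts G) \<Longrightarrow> reduced G k \<in> carrier_vec (nverts G)"
  by simp

lemma finite_lattice_exponents:
  assumes "negative_definite G" "a \<in> carrier_vec (nverts G)"
  shows "finite {l \<in> lattice_class G a. lattice_exponents G l = p}"
  by (rule finite_subset[OF _ finite_GPPV_exponent[OF assms, of "fst p"]])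
     (auto simp: lattice_exponents_def)

text \<open>
  The substitution \<open>l = k - M u + 2 M x\<close> removes every choice from the definition: the right-hand
  side depends on \<open>k\<close> only through a coset of \<open>2 M\<int>\<^sup>s\<close>.
\<close>

theorem two_variable_series_eq_lattice_series:
  assumes nd: "negative_definite G" and k: "k \<in> char_vecs G"
  shows "two_variable_series G k = lattice_series G (lattice_class G (reduced G k))"
proof
  fix p :: "rat \<times> rat"
  have kc: "k \<in> carrier_vec (nverts G)" by (rule char_vecs_carrier[OF k])
  let ?h = "\<lambda>x. reduced G k + 2 \<cdot>\<^sub>v (plumbing_matrix G *\<^sub>v x)"
  let ?S = "{x. x \<in> carrier_vec (nverts G) \<and> lattice_exponents G (?h x) = p}"
  obtain e f where p: "p = (e, f)" by (cases p)
  have "two_variable_series G k p = (\<Sum>x \<in> ?S. lattice_weight G (?h x))"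
    unfolding p two_variable_series_eq[OF assms]
    by (rule sum.cong) (auto simp: lattice_exponents_def eps_eq[OF nd kc] theta_eq[OF kc] Fhat_graph_eq[OF kc])
  also have "\<dots> = (\<Sum>l \<in> ?h ` ?S. lattice_weight G l)"
    by (rule sum.reindex_cong[symmetric, OF inj_on_subset[OF inj_on_lattice_map[OF nd reduced_carrier[OF kc]]] refl])
       auto
  also have "?h ` ?S = {l \<in> lattice_class G (reduced G k). lattice_exponents G l = p}"
    by (auto simp: lattice_class_def)
  finally show "two_variable_series G k p = lattice_series G (lattice_class G (reduced G k)) p"
    by (simp add: lattice_series_def)
qed

lemma lattice_class_carrier:
  "a \<in> carrier_vec (nverts G) \<Longrightarrow> l \<in> lattice_class G a \<Longrightarrow> l \<in> carrier_vec (nverts G)"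
  by (auto simp: lattice_class_def)

lemma lattice_class_self: "k \<in> carrier_vec (nverts G) \<Longrightarrow> k \<in> lattice_class G k"
  by (auto simp: lattice_class_def intro!: exI[of _ "0\<^sub>v (nverts G)"])

lemma lattice_class_reduced:
  assumes k: "k \<in> carrier_vec (nverts G)" and k': "k' \<in> lattice_class G k"
  shows "lattice_class G (reduced G k') = lattice_class G (reduced G k)"
proof -
  obtain y where y: "y \<in> carrier_vec (nverts G)" and ky: "k' = k + 2 \<cdot>\<^sub>v (plumbing_matrix G *\<^sub>v y)"
    using k' by (auto simp: lattice_class_def)
  have 1: "reduced G k' + 2 \<cdot>\<^sub>v (plumbing_matrix G *\<^sub>v x) =
      reduced G k + 2 \<cdot>\<^sub>v (plumbing_matrix G *\<^sub>v (x + y))" if "x \<in> carrier_vec (nverts G)" for x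
    using k y that unfolding ky
    by (intro eq_vecI) (simp_all add: mult_add_distrib_mat_vec[of _ "nverts G" "nverts G"] del: index_mult_mat_vec)
  have 2: "reduced G k + 2 \<cdot>\<^sub>v (plumbing_matrix G *\<^sub>v x) =
      reduced G k' + 2 \<cdot>\<^sub>v (plumbing_matrix G *\<^sub>v (x - y))" if "x \<in> carrier_vec (nverts G)" for x
    using k y that unfolding ky
    by (intro eq_vecI) (simp_all add: mult_minus_distrib_mat_vec[of _ "nverts G" "nverts G"] del: index_mult_mat_vec)
  show ?thesis
    unfolding lattice_class_def using 1 2 y by (blast intro: add_carrier_vec minus_carrier_vec)
qed

lemma char_vecs_lattice_class:
  assumes k: "k \<in> char_vecs G" and k': "k' \<in> lattice_class G k"
  shows "k' \<in> char_vecs G"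
proof -
  obtain x y where x: "x \<in> carrier_vec (nverts G)" "k = weights G + 2 \<cdot>\<^sub>v x"
    and y: "y \<in> carrier_vec (nverts G)" "k' = k + 2 \<cdot>\<^sub>v (plumbing_matrix G *\<^sub>v y)"
    using assms by (auto simp: lattice_class_def char_vecs_def)
  have "k' = weights G + 2 \<cdot>\<^sub>v (x + plumbing_matrix G *\<^sub>v y)"
    unfolding y(2) x(2) using x(1) by (intro eq_vecI) (auto simp: distrib_left simp del: index_mult_mat_vec)
  moreover have "x + plumbing_matrix G *\<^sub>v y \<in> carrier_vec (nverts G)"
    using x(1) by simp
  ultimately show ?thesis unfolding char_vecs_def by (intro CollectI exI conjI)
qed

corollary two_variable_series_lattice_class:
  assumes nd: "negative_definite G" and k: "k \<in> char_vecs G" and k': "k' \<in> lattice_class G k"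
  shows "two_variable_series G k' = two_variable_series G k"
  using two_variable_series_eq_lattice_series[OF nd] char_vecs_lattice_class[OF k k'] k
    lattice_class_reduced[OF char_vecs_carrier[OF k] k'] by metis

section \<open>Specialization to one variable\<close>

theorem specialize_t_1_two_variable_series:
  assumes nd: "negative_definite G" and k: "k \<in> char_vecs G"
  shows "complex_of_rat (specialize_t_1 (two_variable_series G k) e) = GPPV_series G (reduced G k) e"
proof -
  let ?L = "lattice_class G (reduced G k)"
  let ?S = "{l \<in> ?L. - normalization G - inv_square G l / 4 = e}"
  let ?th = "\<lambda>l. rat_of_int (l \<bullet> ones G) / 2"
  let ?Z = "two_variable_series G k"
  have fin: "finite ?S"
    by (rule finite_GPPV_exponent[OF nd reduced_carrier[OF char_vecs_carrier[OF k]]])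
  have Z: "?Z (e, f) = (\<Sum>l | l \<in> ?S \<and> ?th l = f. lattice_weight G l)" for f
    unfolding two_variable_series_eq_lattice_series[OF nd k] lattice_series_def lattice_exponents_def
    by (rule sum.cong) auto
  \<comment> \<open>The set on the right contains the support of the coefficients of \<open>q\<^sup>e\<close> and has the
    advantage that every \<open>l\<close> in \<open>?S\<close> lies over exactly one of its elements.\<close>
  have "specialize_t_1 ?Z e = (\<Sum>f \<in> ?th ` ?S. ?Z (e, f))"
    unfolding specialize_t_1_def
  proof (rule sum.mono_neutral_left)
    show "{f. ?Z (e, f) \<noteq> 0} \<subseteq> ?th ` ?S"
    proof
      fix f assume "f \<in> {f. ?Z (e, f) \<noteq> 0}"
      then have "(\<Sum>l | l \<in> ?S \<and> ?th l = f. lattice_weight G l) \<noteq> 0"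
        by (simp only: Z mem_Collect_eq not_False_eq_True)
      then obtain l where "l \<in> {l. l \<in> ?S \<and> ?th l = f}"
        using sum.not_neutral_contains_not_neutral by blast
      then show "f \<in> ?th ` ?S" by (intro image_eqI[of _ _ l]) simp_all
    qed
  qed (use fin in auto)
  also have "\<dots> = (\<Sum>l \<in> ?S. lattice_weight G l)"
    unfolding Z using sum.image_gen[OF fin, of "lattice_weight G" ?th] by simp
  also have "complex_of_rat \<dots> = (\<Sum>l \<in> ?S. GPPV_bracket G l)"
    unfolding of_rat_sum GPPV_bracket_def pv_integral_eq_Fhat lattice_weight_def of_rat_prod ..
  finally show ?thesis by (simp add: GPPV_series_def)
qed

section \<open>Blow-ups\<close>

lemma inv_square_eq:
  assumes nd: "negative_definite G" and y: "y \<in> carrier_vec (nverts G)"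
    and l: "map_mat rat_of_int (plumbing_matrix G) *\<^sub>v y = map_vec rat_of_int l"
  shows "inv_square G l = map_vec rat_of_int l \<bullet> y"
proof -
  let ?n = "nverts G" and ?M = "map_mat rat_of_int (plumbing_matrix G)"
  obtain B where B: "mat_inverse ?M = Some B" "B \<in> carrier_mat ?n ?n" "B * ?M = 1\<^sub>m ?n"
    by (rule mat_inverse_plumbing_matrix[OF nd])
  have "B *\<^sub>v (?M *\<^sub>v y) = y"
    using assoc_mult_mat_vec[OF B(2) _ y, of ?M] B(3) y by simp
  then show ?thesis by (simp add: inv_square_def B(1) flip: l)
qed

lemma inv_square_obtain:
  assumes nd: "negative_definite G" and l: "l \<in> carrier_vec (nverts G)"
  obtains y where "y \<in> carrier_vec (nverts G)"
    "map_mat rat_of_int (plumbing_matrix G) *\<^sub>v y = map_vec rat_of_int l"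
proof -
  let ?n = "nverts G" and ?M = "map_mat rat_of_int (plumbing_matrix G)"
  obtain B where B: "mat_inverse ?M = Some B" "B \<in> carrier_mat ?n ?n" "?M * B = 1\<^sub>m ?n"
    by (rule mat_inverse_plumbing_matrix[OF nd])
  have "?M *\<^sub>v (B *\<^sub>v map_vec rat_of_int l) = map_vec rat_of_int l"
    using assoc_mult_mat_vec[OF _ B(2), of ?M ?n "map_vec rat_of_int l"] B(3) l by simp
  then show thesis using that[of "B *\<^sub>v map_vec rat_of_int l"] B(2) l by simp
qed

text \<open>
  Both types of blow-up at once.  The vector \<open>D\<close> is the indicator of the neighbours of the new
  vertex: two ends of an edge for type (a), one vertex for type (b).  The new matrix is
  congruent to the block sum of \<open>-1\<close> and \<open>M\<close>, by the shear \<open>(y\<^sub>0, y) \<mapsto> (y\<^sub>0 - D \<bullet> y, y)\<close>.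
\<close>

locale blow_up =
  fixes G G' :: plumbing and D :: "int Matrix.vec"
  assumes D_carrier [simp]: "D \<in> carrier_vec (nverts G)"
    and weights': "weights G' = vCons (-1) (weights G - D)"
    and matrix_0: "i < nverts G \<Longrightarrow> plumbing_matrix G' $$ (0, Suc i) = D $ i"
    and matrix_Suc: "i < nverts G \<Longrightarrow> j < nverts G \<Longrightarrow>
      plumbing_matrix G' $$ (Suc i, Suc j) = plumbing_matrix G $$ (i, j) - D $ i * D $ j"
begin

text \<open>
  \<open>D\<close> with entries in an arbitrary ring; negative definiteness needs the reals and the inverse of
  \<open>M\<close> the rationals.
\<close>

abbreviation D_of_int :: "'a::comm_ring_1 Matrix.vec" where
  "D_of_int \<equiv> map_vec of_int D"

text \<open>
  Every vector for the blown-up plumbing is of this form.  The coordinate \<open>s\<close> belongs to the summand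
  \<open>-1\<close>, so that the square drops by \<open>s\<^sup>2\<close>.
\<close>

abbreviation lift_vec :: "int \<Rightarrow> int Matrix.vec \<Rightarrow> int Matrix.vec" where
  "lift_vec s l \<equiv> vCons (- s) (l + s \<cdot>\<^sub>v D)"

lemma D_dim [simp]: "dim_vec D = nverts G"
  using D_carrier by (rule carrier_vecD)

lemma nverts' [simp]: "nverts G' = Suc (nverts G)"
  by (simp add: weights')

lemma matrix_00: "plumbing_matrix G' $$ (0, 0) = -1"
  by (simp add: plumbing_matrix_def weights')

lemma matrix_0': "i < nverts G \<Longrightarrow> plumbing_matrix G' $$ (Suc i, 0) = D $ i"
  using symmetric_plumbing_matrix[of 0 G' "Suc i"] matrix_0 by simp

lemma mult_blow_up:
  fixes y :: "'a::comm_ring_1 Matrix.vec"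
  assumes y: "y \<in> carrier_vec (nverts G)"
  shows "map_mat of_int (plumbing_matrix G') *\<^sub>v vCons y0 y =
    vCons (D_of_int \<bullet> y - y0)
      (map_mat of_int (plumbing_matrix G) *\<^sub>v y + (y0 - D_of_int \<bullet> y) \<cdot>\<^sub>v D_of_int)"
    (is "?L = ?R")
proof (rule eq_vecI)
  fix i assume "i < dim_vec ?R"
  then consider "i = 0" | v where "i = Suc v" "v < nverts G" by (cases i) auto
  then show "?L $ i = ?R $ i"
  proof cases
    case 1
    then show ?thesis using y
      by (simp add: scalar_prod_def sum.atLeast0_lessThan_Suc_shift matrix_00 matrix_0 del: sum.op_ivl_Suc)
  next
    case 2
    then show ?thesis using y
      by (simp add: scalar_prod_def sum.atLeast0_lessThan_Suc_shift matrix_0' matrix_Suc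
          left_diff_distrib right_diff_distrib sum_subtractf sum_distrib_left sum_distrib_right mult_ac del: sum.op_ivl_Suc)
  qed
qed simp

lemma mult_blow_up_int:
  assumes y: "y \<in> carrier_vec (nverts G)"
  shows "plumbing_matrix G' *\<^sub>v vCons y0 y =
    vCons (D \<bullet> y - y0) (plumbing_matrix G *\<^sub>v y + (y0 - D \<bullet> y) \<cdot>\<^sub>v D)"
proof -
  have "map_mat of_int A = A" "map_vec of_int D = D" for A :: "int mat"
    by (auto intro: eq_matI eq_vecI)
  then show ?thesis using mult_blow_up[OF y, of y0] by simp
qed

lemma quadratic_blow_up:
  fixes y :: "'a::comm_ring_1 Matrix.vec"
  assumes y: "y \<in> carrier_vec (nverts G)"
  shows "vCons y0 y \<bullet> (map_mat of_int (plumbing_matrix G') *\<^sub>v vCons y0 y) =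
    y \<bullet> (map_mat of_int (plumbing_matrix G) *\<^sub>v y) - (y0 - D_of_int \<bullet> y)\<^sup>2"
proof -
  have "map_mat of_int (plumbing_matrix G) *\<^sub>v y \<in> carrier_vec (nverts G)"
    by (intro carrier_vecI) simp
  then show ?thesis
    using y comm_scalar_prod[OF y, of D_of_int]
    by (simp add: mult_blow_up scalar_prod_add_distrib[of _ "nverts G"] power2_eq_square algebra_simps)
qed

lemma negative_definite_blow_up: "negative_definite G' \<longleftrightarrow> negative_definite G"
proof
  assume nd: "negative_definite G'"
  show "negative_definite G"
    unfolding negative_definite_def
  proof (intro ballI impI)
    fix y :: "real Matrix.vec" assume y: "y \<in> carrier_vec (nverts G)" "y \<noteq> 0\<^sub>v (nverts G)"
    \<comment> \<open>The lift on which the new summand of the form vanishes.\<close>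
    let ?y = "vCons (D_of_int \<bullet> y) y"
    have "?y \<in> carrier_vec (nverts G')" "?y \<noteq> 0\<^sub>v (nverts G')" using y by (auto simp: zero_vec_Suc)
    then show "y \<bullet> (map_mat real_of_int (plumbing_matrix G) *\<^sub>v y) < 0"
      using nd quadratic_blow_up[OF y(1), of "D_of_int \<bullet> y"] by (auto simp: negative_definite_def)
  qed
next
  assume nd: "negative_definite G"
  show "negative_definite G'"
    unfolding negative_definite_def
  proof (intro ballI impI)
    fix x :: "real Matrix.vec" assume x: "x \<in> carrier_vec (nverts G')" "x \<noteq> 0\<^sub>v (nverts G')"
    obtain y0 y where xy: "x = vCons y0 y" and y: "y \<in> carrier_vec (nverts G)"
      using x(1) by (cases x) auto
    show "x \<bullet> (map_mat real_of_int (plumbing_matrix G') *\<^sub>v x) < 0"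
    proof (cases "y = 0\<^sub>v (nverts G)")
      case True
      then have "y0 \<noteq> 0" using x(2) xy by (auto simp: zero_vec_Suc)
      moreover have "D_of_int \<bullet> (0\<^sub>v (nverts G) :: real Matrix.vec) = 0"
        by (rule scalar_prod_right_zero) simp
      moreover have "map_mat real_of_int (plumbing_matrix G) *\<^sub>v 0\<^sub>v (nverts G) \<in> carrier_vec (nverts G)"
        by (intro carrier_vecI) simp
      ultimately show ?thesis
        using quadratic_blow_up[OF y, of y0] by (simp add: xy True)
    next
      case False
      then have "y \<bullet> (map_mat real_of_int (plumbing_matrix G) *\<^sub>v y) < 0"
        using nd y by (simp add: negative_definite_def)
      then show ?thesis
        using quadratic_blow_up[OF y, of y0] zero_le_power2[of "y0 - D_of_int \<bullet> y"] unfolding xy by linarith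
    qed
  qed
qed

lemma inv_square_lift_vec:
  assumes nd: "negative_definite G" and l: "l \<in> carrier_vec (nverts G)"
  shows "inv_square G' (lift_vec s l) = inv_square G l - of_int (s\<^sup>2)"
proof -
  obtain y where y: "y \<in> carrier_vec (nverts G)"
    and My: "map_mat rat_of_int (plumbing_matrix G) *\<^sub>v y = map_vec rat_of_int l"
    by (rule inv_square_obtain[OF nd l])
  have map: "map_vec rat_of_int (lift_vec s l) = vCons (- of_int s) (map_vec of_int l + of_int s \<cdot>\<^sub>v D_of_int)"
    using l by (intro eq_vecI) (auto simp: less_Suc_eq_0_disj)
  have "map_mat rat_of_int (plumbing_matrix G') *\<^sub>v vCons (of_int s + D_of_int \<bullet> y) y = map_vec rat_of_int (lift_vec s l)"
    unfolding mult_blow_up[OF y] My map by simp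
  then have "inv_square G' (lift_vec s l) = map_vec rat_of_int (lift_vec s l) \<bullet> vCons (of_int s + D_of_int \<bullet> y) y"
    using nd y by (intro inv_square_eq) (auto simp: negative_definite_blow_up)
  also have "\<dots> = map_vec of_int l \<bullet> y - of_int (s\<^sup>2)"
    unfolding map using l y
    by (simp add: add_scalar_prod_distrib[of _ "nverts G"] power2_eq_square algebra_simps)
  also have "map_vec of_int l \<bullet> y = inv_square G l"
    using inv_square_eq[OF nd y My] by simp
  finally show ?thesis .
qed

lemma ones_blow_up: "ones G' = vCons 1 (ones G)"
  by (simp add: ones_def vec_Suc o_def)

lemma normalization_blow_up: "normalization G' = normalization G + (2 - of_int (D \<bullet> ones G)) / 4"
proof -
  have "(\<Sum>v<nverts G'. weights G' $ v) = -1 + (\<Sum>v<nverts G. weights G $ v - D $ v)"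
    by (simp add: weights' sum.lessThan_Suc_shift del: sum.lessThan_Suc)
  also have "\<dots> = -1 + (\<Sum>v<nverts G. weights G $ v) - D \<bullet> ones G"
    by (simp add: sum_subtractf scalar_prod_def ones_def lessThan_atLeast0)
  finally have sum: "(\<Sum>v<nverts G'. weights G' $ v) = -1 + (\<Sum>v<nverts G. weights G $ v) - D \<bullet> ones G" .
  show ?thesis unfolding normalization_def sum by (simp add: field_simps)
qed

text \<open>
  The map \<open>k \<mapsto> (0, k) + (c, - c D)\<close> on characteristic vectors, with \<open>c = 1\<close> for type (a) and \<open>c = -1\<close> for type (b).
\<close>

lemma reduced_blow_up:
  assumes k: "k \<in> carrier_vec (nverts G)" and e: "e = c + 1 - D \<bullet> ones G"
  shows "reduced G' (vCons 0 k + vCons c (- c \<cdot>\<^sub>v D)) = lift_vec (- e) (reduced G k)"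
  unfolding ones_blow_up mult_blow_up_int[OF ones_carrier] e using k
  by (intro eq_vecI) (auto simp: less_Suc_eq_0_disj algebra_simps simp del: index_mult_mat_vec)

lemma char_vecs_blow_up:
  assumes k: "k \<in> char_vecs G" and c: "odd c"
  shows "vCons 0 k + vCons c (- c \<cdot>\<^sub>v D) \<in> char_vecs G'"
proof -
  obtain x where x: "x \<in> carrier_vec (nverts G)" "k = weights G + 2 \<cdot>\<^sub>v x"
    using k by (auto simp: char_vecs_def)
  obtain b where b: "c = 2 * b + 1" using c by (rule oddE)
  have "vCons 0 k + vCons c (- c \<cdot>\<^sub>v D) = weights G' + 2 \<cdot>\<^sub>v vCons (b + 1) (x - b \<cdot>\<^sub>v D)"
    unfolding weights' x(2) b using x(1)
    by (intro eq_vecI) (auto simp: less_Suc_eq_0_disj algebra_simps)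
  moreover have "vCons (b + 1) (x - b \<cdot>\<^sub>v D) \<in> carrier_vec (nverts G')" using x(1) by simp
  ultimately show ?thesis unfolding char_vecs_def by blast
qed

lemma lattice_class_lift_vec:
  assumes a: "a \<in> carrier_vec (nverts G)"
  shows "lattice_class G' (lift_vec e a) = {lift_vec s l | s l. l \<in> lattice_class G a \<and> even (s - e)}"
    (is "?L = ?R")
proof -
  have eq: "lift_vec e a + 2 \<cdot>\<^sub>v (plumbing_matrix G' *\<^sub>v vCons y0 y) =
      lift_vec (e + 2 * (y0 - D \<bullet> y)) (a + 2 \<cdot>\<^sub>v (plumbing_matrix G *\<^sub>v y))"
    if y: "y \<in> carrier_vec (nverts G)" for y0 y
    unfolding mult_blow_up_int[OF y] using a y
    by (intro eq_vecI) (auto simp: less_Suc_eq_0_disj algebra_simps simp del: index_mult_mat_vec)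
  show ?thesis
  proof (intro equalityI subsetI)
    fix m assume "m \<in> ?L"
    then obtain x where x: "x \<in> carrier_vec (nverts G')" "m = lift_vec e a + 2 \<cdot>\<^sub>v (plumbing_matrix G' *\<^sub>v x)"
      by (auto simp: lattice_class_def)
    then obtain y0 y where xy: "x = vCons y0 y" and y: "y \<in> carrier_vec (nverts G)"
      by (cases x) auto
    have "m = lift_vec (e + 2 * (y0 - D \<bullet> y)) (a + 2 \<cdot>\<^sub>v (plumbing_matrix G *\<^sub>v y))"
      unfolding x(2) xy by (rule eq[OF y])
    moreover have "a + 2 \<cdot>\<^sub>v (plumbing_matrix G *\<^sub>v y) \<in> lattice_class G a"
      using y by (auto simp: lattice_class_def)
    moreover have "even (e + 2 * (y0 - D \<bullet> y) - e)" by simp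
    ultimately show "m \<in> ?R" by blast
  next
    fix m assume "m \<in> ?R"
    then obtain s l where m: "m = lift_vec s l" and l: "l \<in> lattice_class G a" and s: "even (s - e)"
      by blast
    obtain y where y: "y \<in> carrier_vec (nverts G)" "l = a + 2 \<cdot>\<^sub>v (plumbing_matrix G *\<^sub>v y)"
      using l by (auto simp: lattice_class_def)
    obtain t where t: "s = e + 2 * t" using s by (metis add.commute diff_add_cancel evenE)
    have "m = lift_vec e a + 2 \<cdot>\<^sub>v (plumbing_matrix G' *\<^sub>v vCons (t + D \<bullet> y) y)"
      unfolding m y(2) eq[OF y(1)] t by simp
    moreover have "vCons (t + D \<bullet> y) y \<in> carrier_vec (nverts G')" using y by simp
    ultimately show "m \<in> ?L" unfolding lattice_class_def by blast
  qed
qed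

lemma lift_vec_eq_iff:
  assumes "l \<in> carrier_vec (nverts G)" "l' \<in> carrier_vec (nverts G)"
  shows "lift_vec s l = lift_vec s' l' \<longleftrightarrow> s = s' \<and> l = l'"
proof (cases "s = s'")
  case True
  have "l = l'" if e: "l + s \<cdot>\<^sub>v D = l' + s \<cdot>\<^sub>v D"
  proof (rule eq_vecI)
    fix i assume "i < dim_vec l'"
    then show "l $ i = l' $ i" using arg_cong[OF e, of "\<lambda>v. v $ i"] assms by simp
  qed (use assms in simp)
  then show ?thesis using True by auto
qed simp

text \<open>
  The condition on \<open>s\<close> says \<open>s = 0\<close> for type (a), where \<open>D\<close> has two entries \<open>1\<close>, and \<open>s = 1\<close> or
  \<open>s = -1\<close> for type (b), where it has one.
\<close>

lemma lattice_exponents_lift_vec: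
  assumes nd: "negative_definite G" and l: "l \<in> carrier_vec (nverts G)"
    and s: "s\<^sup>2 = 2 - D \<bullet> ones G" "s * (D \<bullet> ones G - 1) = 0"
  shows "lattice_exponents G' (lift_vec s l) = lattice_exponents G l"
proof -
  have "lift_vec s l \<bullet> ones G' = l \<bullet> ones G + s * (D \<bullet> ones G - 1)"
    using l by (simp add: ones_blow_up add_scalar_prod_distrib[of _ "nverts G"]
        smult_scalar_prod_distrib[of _ "nverts G"] algebra_simps)
  moreover have "- normalization G' - inv_square G' (lift_vec s l) / 4 =
      - normalization G - inv_square G l / 4"
    unfolding inv_square_lift_vec[OF nd l] normalization_blow_up s(1) by (simp add: field_simps)
  ultimately show ?thesis using s by (simp add: lattice_exponents_def)
qed

text \<open>
  The vectors \<open>lift_vec s l\<close> with \<open>s \<in> T\<close> belong to the new coset and have the exponents of \<open>l\<close>; those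
  with \<open>s \<notin> T\<close> have coefficient \<open>0\<close>.  So it suffices that the coefficients for \<open>s \<in> T\<close> add up to
  that of \<open>l\<close>.
\<close>

theorem lattice_series_blow_up:
  assumes nd: "negative_definite G" and a: "a \<in> carrier_vec (nverts G)"
    and T: "finite T" "\<And>s. s \<in> T \<Longrightarrow> even (s - e)"
      "\<And>s. s \<in> T \<Longrightarrow> s\<^sup>2 = 2 - D \<bullet> ones G" "\<And>s. s \<in> T \<Longrightarrow> s * (D \<bullet> ones G - 1) = 0"
    and weight_0: "\<And>s l. l \<in> carrier_vec (nverts G) \<Longrightarrow> s \<notin> T \<Longrightarrow> lattice_weight G' (lift_vec s l) = 0"
    and weight: "\<And>l. l \<in> carrier_vec (nverts G) \<Longrightarrow>
      (\<Sum>s\<in>T. lattice_weight G' (lift_vec s l)) = lattice_weight G l"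
  shows "lattice_series G' (lattice_class G' (lift_vec e a)) = lattice_series G (lattice_class G a)"
proof
  fix p
  let ?L = "{l \<in> lattice_class G a. lattice_exponents G l = p}"
  let ?L' = "{l \<in> lattice_class G' (lift_vec e a). lattice_exponents G' l = p}"
  let ?h = "\<lambda>(s, l). lift_vec s l"
  have L: "l \<in> carrier_vec (nverts G)" if "l \<in> ?L" for l
    using lattice_class_carrier[OF a] that by blast
  have "finite ?L'"
    by (rule finite_lattice_exponents) (use nd a in \<open>auto simp: negative_definite_blow_up\<close>)
  then have "(\<Sum>m\<in>?L'. lattice_weight G' m) = (\<Sum>m\<in>?h ` (T \<times> ?L). lattice_weight G' m)"
  proof (rule sum.mono_neutral_right)
    show "?h ` (T \<times> ?L) \<subseteq> ?L'"
      using T(2) lattice_exponents_lift_vec[OF nd L T(3,4)] by (auto simp: lattice_class_lift_vec[OF a])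
    show "\<forall>m \<in> ?L' - ?h ` (T \<times> ?L). lattice_weight G' m = 0"
    proof
      fix m assume m: "m \<in> ?L' - ?h ` (T \<times> ?L)"
      then obtain s l where sl: "m = lift_vec s l" "l \<in> lattice_class G a"
        by (auto simp: lattice_class_lift_vec[OF a])
      have lc: "l \<in> carrier_vec (nverts G)" by (rule lattice_class_carrier[OF a sl(2)])
      have "s \<notin> T"
      proof
        assume s: "s \<in> T"
        then have "lattice_exponents G l = p"
          using m lattice_exponents_lift_vec[OF nd lc T(3)[OF s] T(4)[OF s]] by (simp add: sl)
        then have "m \<in> ?h ` (T \<times> ?L)" using s sl by force
        then show False using m by simp
      qed
      then show "lattice_weight G' m = 0" using weight_0[OF lc] by (simp add: sl)
    qed
  qed
  also have "\<dots> = (\<Sum>(s, l)\<in>T \<times> ?L. lattice_weight G' (lift_vec s l))"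
  proof (rule sum.reindex_cong[where l = ?h])
    show "inj_on ?h (T \<times> ?L)"
      using L by (auto simp: inj_on_def lift_vec_eq_iff simp del: vCons_eq_vCons)
  qed auto
  also have "\<dots> = (\<Sum>l\<in>?L. \<Sum>s\<in>T. lattice_weight G' (lift_vec s l))"
    by (simp add: sum.cartesian_product[symmetric] sum.swap[of _ T])
  also have "\<dots> = (\<Sum>l\<in>?L. lattice_weight G l)"
    by (rule sum.cong[OF refl weight[OF L]])
  finally show "lattice_series G' (lattice_class G' (lift_vec e a)) p = lattice_series G (lattice_class G a) p"
    by (simp add: lattice_series_def)
qed

lemma lattice_weight_lift_vec:
  assumes l: "l \<in> carrier_vec (nverts G)"
  shows "lattice_weight G' (lift_vec s l) = Fhat (vertex_degree G' 0) (- s) *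
    (\<Prod>v<nverts G. Fhat (vertex_degree G' (Suc v)) (l $ v + s * D $ v))"
  using l by (simp add: lattice_weight_def prod.lessThan_Suc_shift del: prod.lessThan_Suc)

theorem two_variable_series_blow_up:
  assumes nd: "negative_definite G" and k: "k \<in> char_vecs G" and c: "odd c"
    and T: "finite T" "\<And>s. s \<in> T \<Longrightarrow> even (s + (c + 1 - D \<bullet> ones G))"
      "\<And>s. s \<in> T \<Longrightarrow> s\<^sup>2 = 2 - D \<bullet> ones G" "\<And>s. s \<in> T \<Longrightarrow> s * (D \<bullet> ones G - 1) = 0"
    and weight_0: "\<And>s l. l \<in> carrier_vec (nverts G) \<Longrightarrow> s \<notin> T \<Longrightarrow> lattice_weight G' (lift_vec s l) = 0"
    and weight: "\<And>l. l \<in> carrier_vec (nverts G) \<Longrightarrow>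
      (\<Sum>s\<in>T. lattice_weight G' (lift_vec s l)) = lattice_weight G l"
  shows "two_variable_series G' (vCons 0 k + vCons c (- c \<cdot>\<^sub>v D)) = two_variable_series G k"
proof -
  let ?e = "- (c + 1 - D \<bullet> ones G)" and ?k = "vCons 0 k + vCons c (- c \<cdot>\<^sub>v D)"
  have kc: "k \<in> carrier_vec (nverts G)" by (rule char_vecs_carrier[OF k])
  have "two_variable_series G' ?k = lattice_series G' (lattice_class G' (reduced G' ?k))"
    using nd by (intro two_variable_series_eq_lattice_series char_vecs_blow_up[OF k c])
      (simp add: negative_definite_blow_up)
  also have "\<dots> = lattice_series G' (lattice_class G' (lift_vec ?e (reduced G k)))"
    by (simp only: reduced_blow_up[OF kc refl])
  also have "\<dots> = lattice_series G (lattice_class G (reduced G k))"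
  proof (rule lattice_series_blow_up[OF nd reduced_carrier[OF kc] T(1) _ T(3,4) weight_0 weight])
    show "even (s - ?e)" if "s \<in> T" for s using T(2)[OF that] by (simp only: diff_minus_eq_add)
  qed
  also have "\<dots> = two_variable_series G k"
    by (rule two_variable_series_eq_lattice_series[OF nd k, symmetric])
  finally show ?thesis .
qed

end

section \<open>The two types of Neumann moves\<close>

lemma finite_edges: "plumbing_graph G \<Longrightarrow> finite (edges G)"
  by (rule finite_subset[of _ "Pow {..<nverts G}"]) (auto simp: plumbing_graph_def)

lemma card_image_Suc_edges:
  "card {e \<in> (`) Suc ` E. Suc v \<in> e} = card {e \<in> E. v \<in> e}"
proof -
  have "{e \<in> (`) Suc ` E. Suc v \<in> e} = (`) Suc ` {e \<in> E. v \<in> e}" by auto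
  then show ?thesis by (simp add: card_image inj_on_def inj_image_eq_iff)
qed

lemma vertex_degree_Suc:
  assumes "finite E" "finite N" "\<And>e. e \<in> N \<Longrightarrow> 0 \<in> e" "edges G' = (`) Suc ` E \<union> N"
  shows "vertex_degree G' (Suc v) = card {e \<in> E. v \<in> e} + card {e \<in> N. Suc v \<in> e}"
    and "vertex_degree G' 0 = card N"
proof -
  have "{e \<in> edges G'. Suc v \<in> e} = {e \<in> (`) Suc ` E. Suc v \<in> e} \<union> {e \<in> N. Suc v \<in> e}"
    using assms(4) by auto
  moreover have "{e \<in> (`) Suc ` E. Suc v \<in> e} \<inter> {e \<in> N. Suc v \<in> e} = {}"
    using assms(3) by auto
  ultimately show "vertex_degree G' (Suc v) = card {e \<in> E. v \<in> e} + card {e \<in> N. Suc v \<in> e}"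
    using assms(1,2) by (simp add: vertex_degree_def card_Un_disjoint card_image_Suc_edges)
  have "{e \<in> edges G'. 0 \<in> e} = N" using assms(3,4) by auto
  then show "vertex_degree G' 0 = card N" by (simp add: vertex_degree_def)
qed

lemma Suc_edge_iff: "{Suc a, Suc b} \<in> (`) Suc ` E \<longleftrightarrow> {a, b} \<in> E"
proof -
  have "inj ((`) Suc)" by (simp add: inj_def inj_image_eq_iff)
  then have "Suc ` {a, b} \<in> (`) Suc ` E \<longleftrightarrow> {a, b} \<in> E" by (rule inj_image_mem_iff)
  then show ?thesis by simp
qed

lemma zero_edge_iff: "{0, Suc a} \<notin> (`) Suc ` E"
proof
  assume "{0, Suc a} \<in> (`) Suc ` E"
  then obtain e where "{0, Suc a} = Suc ` e" by blast
  then have "0 \<in> Suc ` e" by blast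
  then show False by simp
qed

lemma plumbing_matrix_index:
  "i < nverts G \<Longrightarrow> j < nverts G \<Longrightarrow> plumbing_matrix G $$ (i, j) =
    (if i = j then weights G $ i else if {i, j} \<in> edges G then 1 else 0)"
  by (simp add: plumbing_matrix_def)

lemma unit_vec_dot_ones: "i < nverts G \<Longrightarrow> unit_vec (nverts G) i \<bullet> ones G = 1"
  by (simp add: ones_def)

text \<open>
  The new leaf forces \<open>s = 1\<close> or \<open>s = -1\<close>, with opposite signs.  The two terms add up by the
  recursion for the family in the degree.
\<close>

theorem two_variable_series_blow_up_vertex:
  assumes G: "plumbing_graph G" and i: "i < nverts G"
  shows "negative_definite (blow_up_vertex i G) \<longleftrightarrow> negative_definite G"
    and "negative_definite G \<Longrightarrow> k \<in> char_vecs G \<Longrightarrow>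
      two_variable_series (blow_up_vertex i G) (vCons 0 k + vCons (-1) (unit_vec (nverts G) i)) =
      two_variable_series G k"
    and "k \<in> char_vecs G \<Longrightarrow> vCons 0 k + vCons (-1) (unit_vec (nverts G) i) \<in> char_vecs (blow_up_vertex i G)"
proof -
  let ?G' = "blow_up_vertex i G" and ?D = "unit_vec (nverts G) i :: int Matrix.vec"
  have edges: "edges ?G' = (`) Suc ` edges G \<union> {{0, Suc i}}"
    by (simp add: blow_up_vertex_def)
  have nverts: "nverts ?G' = Suc (nverts G)" by (simp add: blow_up_vertex_def)
  interpret blow_up G ?G' ?D
  proof
    show "weights ?G' = vCons (-1) (weights G - ?D)" by (simp add: blow_up_vertex_def)
    show "plumbing_matrix ?G' $$ (0, Suc v) = ?D $ v" if v: "v < nverts G" for v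
    proof -
      have "{0, Suc v} \<in> edges ?G' \<longleftrightarrow> v = i"
        unfolding edges Un_iff by (simp add: zero_edge_iff doubleton_eq_iff)
      then show ?thesis using v i by (simp add: plumbing_matrix_index nverts)
    qed
    show "plumbing_matrix ?G' $$ (Suc v, Suc w) = plumbing_matrix G $$ (v, w) - ?D $ v * ?D $ w"
      if v: "v < nverts G" "w < nverts G" for v w
    proof -
      have "{Suc v, Suc w} \<in> edges ?G' \<longleftrightarrow> {v, w} \<in> edges G"
        unfolding edges Un_iff Suc_edge_iff by (simp add: doubleton_eq_iff)
      then show ?thesis using v i by (simp add: plumbing_matrix_index nverts) (simp add: blow_up_vertex_def)
    qed
  qed simp
  have d: "?D \<bullet> ones G = 1" by (rule unit_vec_dot_ones[OF i])
  note degree = vertex_degree_Suc[OF finite_edges[OF G] _ _ edges]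
  have deg_0: "vertex_degree ?G' 0 = 1" using degree(2) by simp
  have deg_Suc: "vertex_degree ?G' (Suc v) = vertex_degree G v + (if v = i then 1 else 0)" for v
  proof -
    have "{e \<in> {{0, Suc i}}. Suc v \<in> e} = (if v = i then {{0, Suc i}} else {})" by auto
    then show ?thesis using degree(1)[of v] by (simp add: vertex_degree_def)
  qed
  have vec: "vCons 0 k + vCons (-1) ?D = vCons 0 k + vCons (-1) (- (-1) \<cdot>\<^sub>v ?D)" for k by simp
  show "negative_definite ?G' \<longleftrightarrow> negative_definite G" by (rule negative_definite_blow_up)
  show "vCons 0 k + vCons (-1) ?D \<in> char_vecs ?G'" if "k \<in> char_vecs G"
    unfolding vec by (rule char_vecs_blow_up[OF that]) simp
  show "two_variable_series ?G' (vCons 0 k + vCons (-1) ?D) = two_variable_series G k"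
    if nd: "negative_definite G" and k: "k \<in> char_vecs G"
    unfolding vec
  proof (rule two_variable_series_blow_up[OF nd k, where T = "{1, -1}"])
    fix l :: "int Matrix.vec" assume l: "l \<in> carrier_vec (nverts G)"
    define P where "P = (\<Prod>v\<in>{..<nverts G} - {i}. Fhat (vertex_degree G v) (l $ v))"
    have w: "lattice_weight ?G' (lift_vec s l) =
        Fhat 1 (- s) * (Fhat (Suc (vertex_degree G i)) (l $ i + s) * P)" for s
      unfolding lattice_weight_lift_vec[OF l] deg_0 P_def using i
      by (subst prod.remove[of _ i]) (auto simp: deg_Suc intro!: prod.cong)
    show "lattice_weight ?G' (lift_vec s l) = 0" if "s \<notin> {1, -1}" for s
      using that by (simp add: w Fhat_1[unfolded One_nat_def] minus_equation_iff[of s 1])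
    have "(\<Sum>s\<in>{1, -1}. lattice_weight ?G' (lift_vec s l)) =
        (Fhat (Suc (vertex_degree G i)) (l $ i + 1) - Fhat (Suc (vertex_degree G i)) (l $ i - 1)) * P"
      by (simp add: w Fhat_1 left_diff_distrib del: One_nat_def)
    also have "\<dots> = lattice_weight G l"
      unfolding Fhat_Suc_diff lattice_weight_def P_def using i by (subst prod.remove[of "{..<nverts G}" i]) auto
    finally show "(\<Sum>s\<in>{1, -1}. lattice_weight ?G' (lift_vec s l)) = lattice_weight G l" .
  qed (auto simp: d)
qed

text \<open>
  The new vertex has degree \<open>2\<close> and forces \<open>s = 0\<close>, so that terms correspond one to one.
\<close>

theorem two_variable_series_blow_up_edge:
  assumes G: "plumbing_graph G" and ij: "{i, j} \<in> edges G"
  defines "u \<equiv> - unit_vec (nverts G) i - unit_vec (nverts G) j"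
  shows "negative_definite (blow_up_edge i j G) \<longleftrightarrow> negative_definite G"
    and "negative_definite G \<Longrightarrow> k \<in> char_vecs G \<Longrightarrow>
      two_variable_series (blow_up_edge i j G) (vCons 0 k + vCons 1 u) = two_variable_series G k"
    and "k \<in> char_vecs G \<Longrightarrow> vCons 0 k + vCons 1 u \<in> char_vecs (blow_up_edge i j G)"
proof -
  let ?G' = "blow_up_edge i j G"
  let ?D = "unit_vec (nverts G) i + unit_vec (nverts G) j :: int Matrix.vec"
  have i: "i < nverts G" and j: "j < nverts G" and neq: "i \<noteq> j"
    using G ij by (auto simp: plumbing_graph_def card_insert_if split: if_splits)
  have edges: "edges ?G' = (`) Suc ` (edges G - {{i, j}}) \<union> {{0, Suc i}, {0, Suc j}}"
    by (simp add: blow_up_edge_def)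
  have nverts: "nverts ?G' = Suc (nverts G)" by (simp add: blow_up_edge_def)
  have weights: "weights ?G' = vCons (-1) (weights G - ?D)"
    by (auto simp: blow_up_edge_def intro!: eq_vecI)
  interpret blow_up G ?G' ?D
  proof
    show "weights ?G' = vCons (-1) (weights G - ?D)" by (rule weights)
    show "plumbing_matrix ?G' $$ (0, Suc v) = ?D $ v" if v: "v < nverts G" for v
    proof -
      have "{0, Suc v} \<in> edges ?G' \<longleftrightarrow> v = i \<or> v = j"
        unfolding edges Un_iff by (simp add: zero_edge_iff doubleton_eq_iff)
      then show ?thesis using v i j neq by (auto simp: plumbing_matrix_index nverts)
    qed
    show "plumbing_matrix ?G' $$ (Suc v, Suc w) = plumbing_matrix G $$ (v, w) - ?D $ v * ?D $ w"
      if v: "v < nverts G" "w < nverts G" for v w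
    proof -
      have "{Suc v, Suc w} \<in> edges ?G' \<longleftrightarrow> {v, w} \<in> edges G - {{i, j}}"
        unfolding edges Un_iff Suc_edge_iff by (simp add: doubleton_eq_iff)
      then show ?thesis using v i j neq ij
        by (auto simp: plumbing_matrix_index nverts weights doubleton_eq_iff insert_commute)
    qed
  qed simp
  have d: "?D \<bullet> ones G = 2"
    using i j by (simp add: add_scalar_prod_distrib[of _ "nverts G"] ones_def)
  note degree = vertex_degree_Suc[OF finite_subset[OF Diff_subset finite_edges[OF G]] _ _ edges]
  have "vertex_degree ?G' 0 = card {{0, Suc i}, {0, Suc j}}" by (rule degree(2)) auto
  then have deg_0: "vertex_degree ?G' 0 = 2" using neq by (simp add: doubleton_eq_iff)
  have deg_Suc: "vertex_degree ?G' (Suc v) = vertex_degree G v" for v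
  proof -
    have fin: "finite {e \<in> edges G. v \<in> e}" using finite_edges[OF G] by simp
    have new: "{e \<in> {{0, Suc i}, {0, Suc j}}. Suc v \<in> e} = (if v = i \<or> v = j then {{0, Suc v}} else {})"
      by auto
    have old: "{e \<in> edges G - {{i, j}}. v \<in> e} =
        (if v = i \<or> v = j then {e \<in> edges G. v \<in> e} - {{i, j}} else {e \<in> edges G. v \<in> e})"
      by auto
    have "card ({e \<in> edges G. v \<in> e} - {{i, j}}) + 1 = card {e \<in> edges G. v \<in> e}" if "v = i \<or> v = j"
      using card_Suc_Diff1[OF fin, of "{i, j}"] that ij by auto
    moreover have "vertex_degree ?G' (Suc v) = card {e \<in> edges G - {{i, j}}. v \<in> e} +
        card {e \<in> {{0, Suc i}, {0, Suc j}}. Suc v \<in> e}"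
      by (rule degree(1)) auto
    ultimately show ?thesis
      unfolding new old vertex_degree_def[of G] by (cases "v = i \<or> v = j") simp_all
  qed
  have vec: "vCons 0 k + vCons 1 u = vCons 0 k + vCons 1 (- 1 \<cdot>\<^sub>v ?D)" for k
    unfolding u_def by (intro arg_cong2[of _ _ _ _ "(+)"] arg_cong2[of _ _ _ _ vCons] eq_vecI) auto
  show "negative_definite ?G' \<longleftrightarrow> negative_definite G" by (rule negative_definite_blow_up)
  show "vCons 0 k + vCons 1 u \<in> char_vecs ?G'" if "k \<in> char_vecs G"
    unfolding vec by (rule char_vecs_blow_up[OF that]) simp
  show "two_variable_series ?G' (vCons 0 k + vCons 1 u) = two_variable_series G k"
    if nd: "negative_definite G" and k: "k \<in> char_vecs G"
    unfolding vec
  proof (rule two_variable_series_blow_up[OF nd k, where T = "{0}"])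
    fix l :: "int Matrix.vec" assume l: "l \<in> carrier_vec (nverts G)"
    show "lattice_weight ?G' (lift_vec s l) = 0" if "s \<notin> {0}" for s
      unfolding lattice_weight_lift_vec[OF l] deg_0 using that by (simp add: Fhat_2)
    show "(\<Sum>s\<in>{0}. lattice_weight ?G' (lift_vec s l)) = lattice_weight G l"
      unfolding lattice_weight_lift_vec[OF l] deg_0 deg_Suc by (simp add: Fhat_2 lattice_weight_def)
  qed (auto simp: d)
qed

section \<open>Renumbering of vertices\<close>

text \<open>
  Renumbering by a permutation \<open>\<pi>\<close>; all data are transported by \<open>permute_vec \<pi>\<close>.
\<close>

locale relabelling =
  fixes G :: plumbing and \<pi> :: "nat \<Rightarrow> nat"
  assumes perm: "\<pi> permutes {..<nverts G}"
begin

abbreviation "G' \<equiv> relabel \<pi> G"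

lemma dim_permute_vec [simp]: "dim_vec (permute_vec \<pi> x) = dim_vec x"
  by (simp add: permute_vec_def)

lemma nverts_relabel [simp]: "nverts G' = nverts G"
  by (simp add: relabel_def)

lemma permute_vec_carrier [simp]: "permute_vec \<pi> x \<in> carrier_vec n \<longleftrightarrow> x \<in> carrier_vec n"
  unfolding carrier_dim_vec by simp

lemma weights_carrier [simp]: "weights G \<in> carrier_vec (nverts G)"
  by (rule carrier_vecI) simp

lemma mult_of_int_carrier [simp]:
  "map_mat of_int (plumbing_matrix G) *\<^sub>v x \<in> carrier_vec (nverts G)"
  "map_mat of_int (plumbing_matrix G') *\<^sub>v x \<in> carrier_vec (nverts G)"
  by (rule carrier_vecI, simp)+

lemma less_iff [simp]: "\<pi> i < nverts G \<longleftrightarrow> i < nverts G"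
  using permutes_in_image[OF perm, of i] by simp

lemma permute_vec_index [simp]:
  "x \<in> carrier_vec (nverts G) \<Longrightarrow> i < nverts G \<Longrightarrow> permute_vec \<pi> x $ \<pi> i = x $ i"
  using permutes_inverses(2)[OF perm] by (simp add: permute_vec_def)

lemma eq_permuteI:
  assumes "x \<in> carrier_vec (nverts G)" "y \<in> carrier_vec (nverts G)"
    "\<And>i. i < nverts G \<Longrightarrow> x $ \<pi> i = y $ \<pi> i"
  shows "x = y"
proof (rule eq_vecI)
  fix v assume "v < dim_vec y"
  then have "inv_into UNIV \<pi> v < nverts G"
    using assms(2) permutes_in_image[OF permutes_inv[OF perm], of v] by simp
  from assms(3)[OF this] show "x $ v = y $ v" by (simp add: permutes_inverses(1)[OF perm])
qed (use assms in simp)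

lemma permute_vec_inj:
  assumes "x \<in> carrier_vec (nverts G)" "y \<in> carrier_vec (nverts G)" "permute_vec \<pi> x = permute_vec \<pi> y"
  shows "x = y"
proof (rule eq_vecI)
  fix i assume "i < dim_vec y"
  then show "x $ i = y $ i"
    using permute_vec_index[OF assms(1), of i] permute_vec_index[OF assms(2), of i] assms by simp
qed (use assms in simp)

lemma permute_vec_surj:
  assumes "y \<in> carrier_vec (nverts G)"
  obtains x where "x \<in> carrier_vec (nverts G)" "y = permute_vec \<pi> x"
proof
  show "y = permute_vec \<pi> (Matrix.vec (nverts G) (\<lambda>i. y $ \<pi> i))"
    using assms by (intro eq_permuteI) auto
qed simp

lemma permute_vec_add:
  "x \<in> carrier_vec (nverts G) \<Longrightarrow> y \<in> carrier_vec (nverts G) \<Longrightarrow>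
    permute_vec \<pi> (x + y) = permute_vec \<pi> x + permute_vec \<pi> y"
  by (intro eq_permuteI) auto

lemma permute_vec_minus:
  "x \<in> carrier_vec (nverts G) \<Longrightarrow> y \<in> carrier_vec (nverts G) \<Longrightarrow>
    permute_vec \<pi> (x - y) = permute_vec \<pi> x - permute_vec \<pi> y"
  by (intro eq_permuteI) auto

lemma permute_vec_smult:
  "x \<in> carrier_vec (nverts G) \<Longrightarrow> permute_vec \<pi> (c \<cdot>\<^sub>v x) = c \<cdot>\<^sub>v permute_vec \<pi> x"
  by (intro eq_permuteI) auto

lemma permute_map_vec:
  "x \<in> carrier_vec (nverts G) \<Longrightarrow> map_vec f (permute_vec \<pi> x) = permute_vec \<pi> (map_vec f x)"
  by (intro eq_permuteI) auto

lemma sum_permute: "(\<Sum>i = 0..<nverts G. f (\<pi> i)) = (\<Sum>i = 0..<nverts G. f i)"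
  using sum.permute[OF perm, of f] by (simp add: lessThan_atLeast0 o_def)

lemma scalar_prod_permute_vec:
  assumes "x \<in> carrier_vec (nverts G)" "y \<in> carrier_vec (nverts G)"
  shows "permute_vec \<pi> x \<bullet> permute_vec \<pi> y = x \<bullet> y"
  using assms sum_permute[of "\<lambda>i. permute_vec \<pi> x $ i * permute_vec \<pi> y $ i"]
  by (simp add: scalar_prod_def)

lemma image_edge_iff: "\<pi> ` e \<in> edges G' \<longleftrightarrow> e \<in> edges G"
  using inj_image_eq_iff[OF permutes_inj[OF perm]] by (auto simp: relabel_def)

lemma matrix_relabel:
  assumes "i < nverts G" "j < nverts G"
  shows "plumbing_matrix G' $$ (\<pi> i, \<pi> j) = plumbing_matrix G $$ (i, j)"
proof -
  have "weights G' $ \<pi> i = weights G $ i"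
    using assms(1) by (simp add: relabel_def)
  moreover have "\<pi> i = \<pi> j \<longleftrightarrow> i = j" using permutes_inj[OF perm] by (auto simp: inj_def)
  ultimately show ?thesis
    using assms image_edge_iff[of "{i, j}"] by (cases "i = j") (simp_all add: plumbing_matrix_def)
qed

lemma mult_relabel:
  fixes x :: "'a::comm_ring_1 Matrix.vec"
  assumes x: "x \<in> carrier_vec (nverts G)"
  shows "map_mat of_int (plumbing_matrix G') *\<^sub>v permute_vec \<pi> x =
    permute_vec \<pi> (map_mat of_int (plumbing_matrix G) *\<^sub>v x)"
proof (rule eq_permuteI)
  have c: "map_mat of_int (plumbing_matrix G) *\<^sub>v x \<in> carrier_vec (nverts G)"
    by (intro carrier_vecI) simp
  then show "permute_vec \<pi> (map_mat of_int (plumbing_matrix G) *\<^sub>v x) \<in> carrier_vec (nverts G)" by simp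
  fix i assume i: "i < nverts G"
  have "(map_mat of_int (plumbing_matrix G') *\<^sub>v permute_vec \<pi> x) $ \<pi> i =
    (\<Sum>j = 0..<nverts G. of_int (plumbing_matrix G' $$ (\<pi> i, j)) * permute_vec \<pi> x $ j)"
    using i x by (simp add: scalar_prod_def)
  also have "\<dots> = (\<Sum>j = 0..<nverts G. of_int (plumbing_matrix G $$ (i, j)) * x $ j)"
    using i x by (subst sum_permute[symmetric]) (simp add: matrix_relabel)
  also have "\<dots> = (map_mat of_int (plumbing_matrix G) *\<^sub>v x) $ i"
    using i x by (simp add: scalar_prod_def)
  finally show "(map_mat of_int (plumbing_matrix G') *\<^sub>v permute_vec \<pi> x) $ \<pi> i =
      permute_vec \<pi> (map_mat of_int (plumbing_matrix G) *\<^sub>v x) $ \<pi> i"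
    unfolding permute_vec_index[OF c i] .
qed simp

lemma mult_relabel_int:
  assumes "x \<in> carrier_vec (nverts G)"
  shows "plumbing_matrix G' *\<^sub>v permute_vec \<pi> x = permute_vec \<pi> (plumbing_matrix G *\<^sub>v x)"
proof -
  have "map_mat of_int A = A" for A :: "int mat"
    by (auto intro: eq_matI)
  then show ?thesis using mult_relabel[OF assms] by simp
qed

lemma negative_definite_relabel: "negative_definite G' \<longleftrightarrow> negative_definite G"
proof -
  have *: "permute_vec \<pi> x \<bullet> (map_mat real_of_int (plumbing_matrix G') *\<^sub>v permute_vec \<pi> x) =
      x \<bullet> (map_mat real_of_int (plumbing_matrix G) *\<^sub>v x)" if "x \<in> carrier_vec (nverts G)" for x
    unfolding mult_relabel[OF that]
    by (rule scalar_prod_permute_vec[OF that]) simp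
  have 0: "permute_vec \<pi> (0\<^sub>v (nverts G)) = (0\<^sub>v (nverts G) :: real Matrix.vec)"
    by (rule eq_permuteI) simp_all
  then have nz: "permute_vec \<pi> x = 0\<^sub>v (nverts G) \<longleftrightarrow> x = 0\<^sub>v (nverts G)"
    if "x \<in> carrier_vec (nverts G)" for x :: "real Matrix.vec"
    using permute_vec_inj[OF that zero_carrier_vec] by auto
  show ?thesis
  proof
    assume "negative_definite G'"
    then show "negative_definite G"
      unfolding negative_definite_def nverts_relabel by (metis * nz permute_vec_carrier)
  next
    assume nd: "negative_definite G"
    show "negative_definite G'"
      unfolding negative_definite_def nverts_relabel
    proof (intro ballI impI)
      fix y :: "real Matrix.vec" assume y: "y \<in> carrier_vec (nverts G)" "y \<noteq> 0\<^sub>v (nverts G)"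
      obtain x where x: "x \<in> carrier_vec (nverts G)" "y = permute_vec \<pi> x"
        by (rule permute_vec_surj[OF y(1)])
      then show "y \<bullet> (map_mat real_of_int (plumbing_matrix G') *\<^sub>v y) < 0"
        using nd y(2) by (simp add: * nz negative_definite_def)
    qed
  qed
qed

lemma ones_relabel: "ones G' = permute_vec \<pi> (ones G)"
  by (rule eq_permuteI) (simp_all add: ones_def)

lemma reduced_relabel:
  "k \<in> carrier_vec (nverts G) \<Longrightarrow> reduced G' (permute_vec \<pi> k) = permute_vec \<pi> (reduced G k)"
  by (simp add: ones_relabel mult_relabel_int permute_vec_minus)

lemma normalization_relabel: "normalization G' = normalization G"
proof -
  have "(\<Sum>v = 0..<nverts G. weights G' $ v) = (\<Sum>v = 0..<nverts G. weights G' $ \<pi> v)"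
    by (rule sum_permute[symmetric])
  also have "\<dots> = (\<Sum>v = 0..<nverts G. weights G $ v)"
    by (rule sum.cong) (simp_all add: relabel_def)
  finally have "(\<Sum>v<nverts G'. weights G' $ v) = (\<Sum>v<nverts G. weights G $ v)"
    by (simp add: lessThan_atLeast0)
  then show ?thesis unfolding normalization_def by simp
qed

lemma inv_square_relabel:
  assumes nd: "negative_definite G" and l: "l \<in> carrier_vec (nverts G)"
  shows "inv_square G' (permute_vec \<pi> l) = inv_square G l"
proof -
  obtain y where y: "y \<in> carrier_vec (nverts G)"
    and My: "map_mat rat_of_int (plumbing_matrix G) *\<^sub>v y = map_vec rat_of_int l"
    by (rule inv_square_obtain[OF nd l])
  have "inv_square G' (permute_vec \<pi> l) = map_vec rat_of_int (permute_vec \<pi> l) \<bullet> permute_vec \<pi> y"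
    using nd y l by (intro inv_square_eq) (auto simp: negative_definite_relabel mult_relabel My permute_map_vec)
  also have "\<dots> = map_vec rat_of_int l \<bullet> y"
    using l y by (simp add: permute_map_vec scalar_prod_permute_vec)
  finally show ?thesis using inv_square_eq[OF nd y My] by simp
qed

lemma vertex_degree_relabel: "vertex_degree G' (\<pi> v) = vertex_degree G v"
proof -
  have "{e \<in> edges G'. \<pi> v \<in> e} = (`) \<pi> ` {e \<in> edges G. v \<in> e}"
    using permutes_inj[OF perm] by (auto simp: relabel_def inj_def)
  moreover have "inj ((`) \<pi>)" using permutes_inj[OF perm] by (simp add: inj_def inj_image_eq_iff)
  ultimately show ?thesis by (simp add: vertex_degree_def card_image inj_on_subset)
qed

lemma lattice_weight_relabel:
  assumes "l \<in> carrier_vec (nverts G)"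
  shows "lattice_weight G' (permute_vec \<pi> l) = lattice_weight G l"
  unfolding lattice_weight_def nverts_relabel
  by (subst prod.permute[OF perm]) (use assms in \<open>simp add: vertex_degree_relabel\<close>)

lemma char_vecs_relabel:
  assumes "k \<in> char_vecs G"
  shows "permute_vec \<pi> k \<in> char_vecs G'"
proof -
  obtain x where x: "x \<in> carrier_vec (nverts G)" "k = weights G + 2 \<cdot>\<^sub>v x"
    using assms by (auto simp: char_vecs_def)
  have "permute_vec \<pi> k = weights G' + 2 \<cdot>\<^sub>v permute_vec \<pi> x"
    using x by (simp add: permute_vec_add permute_vec_smult relabel_def)
  moreover have "permute_vec \<pi> x \<in> carrier_vec (nverts G')" using x by simp
  ultimately show ?thesis unfolding char_vecs_def by blast
qed

lemma lattice_class_relabel: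
  assumes a: "a \<in> carrier_vec (nverts G)"
  shows "lattice_class G' (permute_vec \<pi> a) = permute_vec \<pi> ` lattice_class G a"
proof -
  have eq: "permute_vec \<pi> a + 2 \<cdot>\<^sub>v (plumbing_matrix G' *\<^sub>v permute_vec \<pi> x) =
      permute_vec \<pi> (a + 2 \<cdot>\<^sub>v (plumbing_matrix G *\<^sub>v x))" if "x \<in> carrier_vec (nverts G)" for x
    using a that by (simp add: mult_relabel_int permute_vec_add permute_vec_smult)
  have "carrier_vec (nverts G) = permute_vec \<pi> ` (carrier_vec (nverts G) :: int Matrix.vec set)"
    by (auto elim: permute_vec_surj)
  then have "lattice_class G' (permute_vec \<pi> a) =
    (\<lambda>x. permute_vec \<pi> a + 2 \<cdot>\<^sub>v (plumbing_matrix G' *\<^sub>v x)) ` permute_vec \<pi> ` carrier_vec (nverts G)"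
    by (auto simp: lattice_class_def)
  also have "\<dots> = (\<lambda>x. permute_vec \<pi> (a + 2 \<cdot>\<^sub>v (plumbing_matrix G *\<^sub>v x))) ` carrier_vec (nverts G)"
    unfolding image_image by (rule image_cong[OF refl eq])
  finally show ?thesis by (auto simp: lattice_class_def)
qed

theorem two_variable_series_relabel:
  assumes nd: "negative_definite G" and k: "k \<in> char_vecs G"
  shows "two_variable_series G' (permute_vec \<pi> k) = two_variable_series G k"
proof -
  let ?L = "lattice_class G (reduced G k)" and ?\<sigma> = "permute_vec \<pi> :: int Matrix.vec \<Rightarrow> int Matrix.vec"
  have kc: "k \<in> carrier_vec (nverts G)" by (rule char_vecs_carrier[OF k])
  have nd': "negative_definite G'" using nd by (simp add: negative_definite_relabel)
  have L: "l \<in> carrier_vec (nverts G)" if "l \<in> ?L" for l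
    using lattice_class_carrier[OF _ that] kc by simp
  have inj: "inj_on ?\<sigma> ?L"
    by (rule inj_onI) (rule permute_vec_inj[OF L L])
  have exponents: "lattice_exponents G' (?\<sigma> l) = lattice_exponents G l" if "l \<in> ?L" for l
    using L[OF that]
    by (simp add: lattice_exponents_def normalization_relabel inv_square_relabel[OF nd] ones_relabel scalar_prod_permute_vec)
  have "two_variable_series G' (?\<sigma> k) = lattice_series G' (?\<sigma> ` ?L)"
    using two_variable_series_eq_lattice_series[OF nd' char_vecs_relabel[OF k]] kc
    by (simp add: reduced_relabel lattice_class_relabel)
  also have "\<dots> = lattice_series G ?L"
  proof
    fix p
    have "{l \<in> ?\<sigma> ` ?L. lattice_exponents G' l = p} = ?\<sigma> ` {l \<in> ?L. lattice_exponents G l = p}"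
      using exponents by auto
    then show "lattice_series G' (?\<sigma> ` ?L) p = lattice_series G ?L p"
      unfolding lattice_series_def
      by (intro sum.reindex_cong[where l = ?\<sigma>]) (auto intro: inj_on_subset[OF inj] simp: lattice_weight_relabel[OF L])
  qed
  also have "\<dots> = two_variable_series G k"
    by (rule two_variable_series_eq_lattice_series[OF nd k, symmetric])
  finally show ?thesis .
qed

end

section \<open>Invariance\<close>

text \<open>
  The set of series of all representatives, together with negative definiteness.  Carrying the
  latter along allows chains of moves without any assumption on the intermediate plumbings.
\<close>

definition class_invariant ::
    "plumbing \<times> int Matrix.vec set \<Rightarrow> bool \<times> (rat \<times> rat \<Rightarrow> rat) set" where
  "class_invariant = (\<lambda>(G, K). (negative_definite G,
     if negative_definite G then two_variable_series G ` K else {}))"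

lemma class_invariant_lattice_class:
  assumes k: "k \<in> char_vecs G"
  shows "class_invariant (G, lattice_class G k) =
    (negative_definite G, if negative_definite G then {two_variable_series G k} else {})"
proof -
  have "two_variable_series G ` lattice_class G k = {two_variable_series G k}" if nd: "negative_definite G"
  proof -
    have "two_variable_series G ` lattice_class G k = (\<lambda>_. two_variable_series G k) ` lattice_class G k"
      by (rule image_cong[OF refl two_variable_series_lattice_class[OF nd k]])
    also have "\<dots> = {two_variable_series G k}"
      by (rule image_constant[OF lattice_class_self[OF char_vecs_carrier[OF k]]])
    finally show ?thesis .
  qed
  then show ?thesis by (simp add: class_invariant_def)
qed

lemma class_invariant_spinc_move:
  "spinc_move p q \<Longrightarrow> class_invariant p = class_invariant q"
proof (induction rule: spinc_move.induct)
  case (type_a G i j k)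
  then have G: "plumbing_graph G" by (simp add: plumbing_tree_def)
  note edge = two_variable_series_blow_up_edge[OF G type_a(2)]
  show ?case
    using edge(1) edge(2)[OF _ type_a(3)]
    by (simp add: class_invariant_lattice_class[OF type_a(3)] class_invariant_lattice_class[OF edge(3)[OF type_a(3)]])
next
  case (type_b G i k)
  then have G: "plumbing_graph G" by (simp add: plumbing_tree_def)
  note vertex = two_variable_series_blow_up_vertex[OF G type_b(2)]
  show ?case
    using vertex(1) vertex(2)[OF _ type_b(3)]
    by (simp add: class_invariant_lattice_class[OF type_b(3)] class_invariant_lattice_class[OF vertex(3)[OF type_b(3)]])
next
  case (renumber G \<pi> k)
  interpret relabelling G \<pi> by (rule relabelling.intro) fact
  show ?case
    using two_variable_series_relabel[OF _ renumber(3)] char_vecs_relabel[OF renumber(3)]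
    by (simp add: class_invariant_lattice_class renumber(3) negative_definite_relabel)
qed

lemma class_invariant_neumann_related:
  assumes "neumann_related p q"
  shows "class_invariant p = class_invariant q"
  using assms unfolding neumann_related_def
  by (induction rule: equivclp_induct) (auto dest: class_invariant_spinc_move)

theorem two_variable_series_invariant:
  assumes "negative_definite G1" "K1 \<in> spinc_structures G1"
    and "negative_definite G2" "K2 \<in> spinc_structures G2"
    and "neumann_related (G1, K1) (G2, K2)" "k1 \<in> K1" "k2 \<in> K2"
  shows "two_variable_series G1 k1 = two_variable_series G2 k2"
proof -
  have "\<exists>Z. class_invariant (G, K) = (True, {Z})"
    if "negative_definite G" "K \<in> spinc_structures G" for G K
    using that class_invariant_lattice_class by (auto simp: spinc_structures_def)
  then obtain Z1 where Z1: "class_invariant (G1, K1) = (True, {Z1})"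
    using assms(1,2) by blast
  moreover have "class_invariant (G2, K2) = (True, {Z1})"
    using Z1 class_invariant_neumann_related[OF assms(5)] by simp
  ultimately have "two_variable_series G1 ` K1 = {Z1}" "two_variable_series G2 ` K2 = {Z1}"
    using assms(1,3) by (simp_all add: class_invariant_def)
  then have "two_variable_series G1 k1 \<in> {Z1}" "two_variable_series G2 k2 \<in> {Z1}"
    using assms(6,7) by blast+
  then show ?thesis by simp
qed

theorem theorem1p2:
  shows "(\<forall>G1 G2 K1 K2 k1 k2.
            plumbing_tree G1 \<and> negative_definite G1 \<and> K1 \<in> spinc_structures G1 \<and>
            plumbing_tree G2 \<and> negative_definite G2 \<and> K2 \<in> spinc_structures G2 \<and>
            neumann_related (G1, K1) (G2, K2) \<and> k1 \<in> K1 \<and> k2 \<in> K2 \<longrightarrow>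
            two_variable_series G1 k1 = two_variable_series G2 k2) \<and>
         (\<forall>G k.
            plumbing_tree G \<and> negative_definite G \<and> k \<in> char_vecs G \<longrightarrow>
            (\<forall>e. complex_of_rat (specialize_t_1 (two_variable_series G k) e) =
                 GPPV_series G (k - plumbing_matrix G *\<^sub>v ones G) e))"
  using two_variable_series_invariant specialize_t_1_two_variable_series by blast

end
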